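(* Let $q = q_n$ and $\delta = \delta_n$ scale with $n$ so that $k \coloneqq (1-\delta)n/q$ is a positive integer and $k = \omega(\sqrt{n \log n})$. Then there is a polynomial-time algorithm which, given a graph $G \sim \mathrm{MC}(n,q,\delta)$, exactly recovers the clique partition (and identifies the non-clique vertices) with probability $1-o(1)$ as $n \to \infty$.
   Context: The model $\mathrm{MC}(n,q,\delta)$: one observes an $n$-vertex graph in which $(1-\delta)n$ of the vertices are partitioned into $q$ cliques, each of size exactly $k = (1-\delta)n/q$ (assumed an integer). Two vertices in the same clique are always connected, and all remaining pairs of vertices are connected independently with probability $1/2$. "Exact recovery" means outputting exactly the partition of the clique vertices into the $q$ cliques together with the set of non-clique vertices. Asymptotics are as $n\to\infty$. *)

theory Defs
  imports
    "HOL-Probability.Probability"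
    "HOL-Probability.Product_PMF"
    "HOL-Library.Landau_Symbols"
    "HOL-Library.Disjoint_Sets"
    "HOL-Computational_Algebra.Polynomial"
begin

section \<open>Polynomial-time algorithms\<close>

text \<open>
  The machine model is the random access machine with additive arithmetic under the uniform
  (unit) cost criterion, restricted to a finite program that is the same for all input lengths.
  As there is neither multiplication nor shifting, \<open>t\<close> steps enlarge
  the bit length of the largest stored number by at most \<open>t\<close> (up to the constants
  in the program), so this machine and a Turing machine simulate each other with
  polynomial overhead. Finitely many registers, addressed directly by the program, are kept
  apart from the memory, which is addressed indirectly through the registers.
\<close>

datatype instr =
    LoadConst nat nat      \<comment> \<open>\<open>R\<^sub>i := c\<close>\<close>
  | Add nat nat nat        \<comment> \<open>\<open>R\<^sub>i := R\<^sub>j + R\<^sub>l\<close>\<close>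
  | Sub nat nat nat        \<comment> \<open>\<open>R\<^sub>i := R\<^sub>j - R\<^sub>l\<close>, truncated at \<open>0\<close>\<close>
  | Load nat nat           \<comment> \<open>\<open>R\<^sub>i := M[R\<^sub>j]\<close>\<close>
  | Store nat nat          \<comment> \<open>\<open>M[R\<^sub>i] := R\<^sub>j\<close>\<close>
  | JumpZero nat nat       \<comment> \<open>if \<open>R\<^sub>i = 0\<close> then go to instruction number \<open>l\<close>\<close>

type_synonym program = "instr list"

record config =
  pc :: nat
  reg :: "nat \<Rightarrow> nat"
  mem :: "nat \<Rightarrow> nat"

fun exec_instr :: "instr \<Rightarrow> config \<Rightarrow> config" where
  "exec_instr (LoadConst i c) s = s\<lparr>pc := Suc (pc s), reg := (reg s)(i := c)\<rparr>"
| "exec_instr (Add i j l) s = s\<lparr>pc := Suc (pc s), reg := (reg s)(i := reg s j + reg s l)\<rparr>"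
| "exec_instr (Sub i j l) s = s\<lparr>pc := Suc (pc s), reg := (reg s)(i := reg s j - reg s l)\<rparr>"
| "exec_instr (Load i j) s = s\<lparr>pc := Suc (pc s), reg := (reg s)(i := mem s (reg s j))\<rparr>"
| "exec_instr (Store i j) s = s\<lparr>pc := Suc (pc s), mem := (mem s)(reg s i := reg s j)\<rparr>"
| "exec_instr (JumpZero i l) s = s\<lparr>pc := (if reg s i = 0 then l else Suc (pc s))\<rparr>"

definition halted :: "program \<Rightarrow> config \<Rightarrow> bool" where
  "halted prog s \<longleftrightarrow> length prog \<le> pc s"

definition step :: "program \<Rightarrow> config \<Rightarrow> config" where
  "step prog s = (if halted prog s then s else exec_instr (prog ! pc s) s)"

text \<open>
  Inputs are bit strings: register 0 holds the length and the bits are stored in memory from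
  address 0 on. Outputs, which are words of natural numbers, are read off in the same way.
\<close>

definition init_config :: "bool list \<Rightarrow> config" where
  "init_config w =
     \<lparr>pc = 0,
      reg = (\<lambda>i. if i = 0 then length w else 0),
      mem = (\<lambda>i. if i < length w \<and> w ! i then 1 else 0)\<rparr>"

definition output_word :: "config \<Rightarrow> nat list" where
  "output_word s = map (mem s) [0..<reg s 0]"

text \<open>
  Halted configurations are fixed by \<^const>\<open>step\<close>, so being halted after exactly \<open>t\<close>
  steps means having stopped within \<open>t\<close> steps.
\<close>

definition polynomial_time :: "(bool list \<Rightarrow> nat list) \<Rightarrow> bool" where
  "polynomial_time f \<longleftrightarrow>
     (\<exists>(prog :: program) (p :: nat poly). \<forall>w.
        let s = (step prog ^^ poly p (length w)) (init_config w)
        in halted prog s \<and> output_word s = f w)"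

section \<open>The multiple planted clique model\<close>

text \<open>
  The vertex set is \<open>{..<n}\<close>, and a simple graph is identified with its set of edges,
  each edge being a two-element set of vertices.
\<close>

type_synonym graph = "nat set set"

definition vertex_pairs :: "nat \<Rightarrow> nat set set" where
  "vertex_pairs n = {e. e \<subseteq> {..<n} \<and> card e = 2}"

text \<open>
  The admissible ground truths: the set of the \<open>q\<close> planted cliques,
  which partition \<open>(1 - \<delta>) n\<close> of the vertices.
\<close>

definition planted_partitions :: "nat \<Rightarrow> nat \<Rightarrow> real \<Rightarrow> nat set set set" where
  "planted_partitions n q \<delta> =
     {P. \<exists>S \<subseteq> {..<n}. real (card S) = (1 - \<delta>) * real n \<and> partition_on S P \<and>
         card P = q \<and> (\<forall>C\<in>P. real (card C) = (1 - \<delta>) * real n / real q)}"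

definition planted_graph :: "nat \<Rightarrow> nat set set \<Rightarrow> graph pmf" where
  "planted_graph n P =
     map_pmf (\<lambda>X. {e \<in> vertex_pairs n. X e})
       (Pi_pmf (vertex_pairs n) False
         (\<lambda>e. bernoulli_pmf (if \<exists>C\<in>P. e \<subseteq> C then 1 else 1 / 2)))"

text \<open>
  The joint law of the planted partition and the observed graph. The model does not prescribe how
  the planted partition is chosen, so its law is a parameter; point masses give a fixed planted
  partition and \<^const>\<open>pmf_of_set\<close> a uniformly random one.
\<close>

definition MC :: "nat \<Rightarrow> nat set set pmf \<Rightarrow> (nat set set \<times> graph) pmf" where
  "MC n law =
     bind_pmf law (\<lambda>P. map_pmf (\<lambda>G. (P, G)) (planted_graph n P))"

section \<open>Exact recovery\<close>

text \<open>The adjacency matrix, row by row. It has \<open>n\<^sup>2\<close> bits, so \<open>n\<close> need not be given separately.\<close>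

definition encode_graph :: "nat \<Rightarrow> graph \<Rightarrow> bool list" where
  "encode_graph n G = map (\<lambda>i. {i div n, i mod n} \<in> G) [0..<n * n]"

text \<open>
  The output assigns a label to every vertex: label 0 marks the non-clique vertices, and the
  vertices sharing a positive label form a clique of the partition. Which positive labels are
  used is immaterial.
\<close>

definition non_clique_vertices :: "nat list \<Rightarrow> nat set" where
  "non_clique_vertices xs = {v. v < length xs \<and> xs ! v = 0}"

definition clique_partition :: "nat list \<Rightarrow> nat set set" where
  "clique_partition xs =
     (\<lambda>c. {v. v < length xs \<and> xs ! v = c}) ` {c \<in> set xs. c > 0}"

definition exactly_recovers :: "nat \<Rightarrow> nat list \<Rightarrow> nat set set \<Rightarrow> bool" where
  "exactly_recovers n xs P \<longleftrightarrow>
     length xs = n \<and> clique_partition xs = P \<and> non_clique_vertices xs = {..<n} - \<Union>P"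

end

theory Submission
  imports Defs
begin

text \<open>Counting common neighbours instead of agreements would not do. With expected counts
  about \<open>n/4\<close> outside the cliques, about \<open>n/4 + k/2\<close> for two different
  cliques and about \<open>n/4 + 3k/4\<close> within one, a cut-off would have to know
  \<open>k\<close>. In terms of signs, an agreement score is a sum of products whose means are
  \<open>(2p - 1)(2p' - 1)\<close>, and one fair coin already makes such a mean 0. This matters
  since \<open>q\<close>, \<open>\<delta>\<close> and \<open>k\<close> are arbitrary sequences,
  while the machine sees only the adjacency matrix. The constant 32 is set by the union bound: if
  the threshold \<open>t\<close> satisfies \<open>t^2 \<ge> 32 n ln n\<close>, a deviation of
  \<open>t/2\<close> has probability at most \<open>2 n^-4\<close> for each pair, hence at most
  \<open>2 n^-2\<close> for all pairs. The bound is uniform in the planted partition, so the law of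
  the partition is immaterial. Running time is proved on the concrete machine. As it lacks
  multiplication, squares, logarithms and row addresses are all accumulated by additions.\<close>

text \<open>
  Call two vertices similar if their adjacency vectors agree in clearly more than half of the
  coordinates. For vertices of a common clique, the clique contributes \<open>k - 2\<close> certain
  agreements; in all other cases, and in all other coordinates, at least one of the two compared
  edges is a fair coin, so an agreement has probability exactly \<open>1/2\<close>. The coordinates are
  independent, so by Hoeffding's inequality all \<open>n\<^sup>2\<close> excesses of agreements over
  disagreements are within \<open>O(sqrt (n log n)) = o(k)\<close> of their means \<open>k - 2\<close> and
  \<open>0\<close>. A threshold of order \<open>sqrt (n log n)\<close>, which does not depend on \<open>k\<close>,
  thus makes similarity coincide with lying in a common clique.
\<close>

section \<open>Bounded loop programs\<close>

text \<open>
  Every loop makes as many iterations as register 0 (the input length) says, which no loop program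
  overwrites, so the running time is a polynomial determined by the syntax. Register 1
  is the scratch register of loops, register 2 is constantly 0 and register 3 constantly 1.
\<close>

datatype com =
    Ins instr
  | Seq com com  (infixr \<open>;;\<close> 60)
  | IfNZ nat com
  | For nat com

fun is_jump :: "instr \<Rightarrow> bool" where
  "is_jump (JumpZero _ _) = True"
| "is_jump _ = False"

fun dest :: "instr \<Rightarrow> nat set" where
  "dest (LoadConst i _) = {i}"
| "dest (Add i _ _) = {i}"
| "dest (Sub i _ _) = {i}"
| "dest (Load i _) = {i}"
| "dest _ = {}"

fun written :: "com \<Rightarrow> nat set" where
  "written (Ins i) = dest i"
| "written (c ;; d) = written c \<union> written d"
| "written (IfNZ _ c) = written c"
| "written (For i c) = insert 1 (insert i (written c))"

fun stores :: "com \<Rightarrow> bool" where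
  "stores (Ins (Store _ _)) = True"
| "stores (Ins _) = False"
| "stores (c ;; d) = (stores c \<or> stores d)"
| "stores (IfNZ _ c) = stores c"
| "stores (For _ c) = stores c"

text \<open>Jumps may come only from the compiler, registers 0 to 3 are reserved, and a loop body
  leaves its own counter alone, so nested loops need distinct counters.\<close>

fun wf_com :: "com \<Rightarrow> bool" where
  "wf_com (Ins i) = (\<not> is_jump i \<and> dest i \<inter> {..3} = {})"
| "wf_com (c ;; d) = (wf_com c \<and> wf_com d)"
| "wf_com (IfNZ _ c) = wf_com c"
| "wf_com (For i c) = (wf_com c \<and> 3 < i \<and> i \<notin> written c)"

definition set_reg :: "config \<Rightarrow> nat \<Rightarrow> nat \<Rightarrow> config" where
  "set_reg s r x = s\<lparr>reg := (reg s)(r := x)\<rparr>"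

lemma set_reg_simps [simp]:
  "reg (set_reg s r x) = (reg s)(r := x)"
  "mem (set_reg s r x) = mem s"
  "pc (set_reg s r x) = pc s"
  by (simp_all add: set_reg_def)

text \<open>The scratch register is tracked exactly as the compiled loop leaves it: the number of
  remaining rounds before each body, 0 on exit. Simulation can then be stated as equality of
  configurations. The \<open>pc\<close> is merely carried along.\<close>

fun sem :: "com \<Rightarrow> config \<Rightarrow> config" where
  "sem (Ins i) s = (exec_instr i s)\<lparr>pc := pc s\<rparr>"
| "sem (c ;; d) s = sem d (sem c s)"
| "sem (IfNZ r c) s = (if reg s r = 0 then s else sem c s)"
| "sem (For i c) s =
     set_reg (((\<lambda>s. let s' = sem c (set_reg s 1 (reg s 0 - reg s i))
                    in set_reg s' i (reg s' i + reg s' 3)) ^^ reg s 0) (set_reg s i 0)) 1 0"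

lemma sem_reg_unwritten: "r \<notin> written c \<Longrightarrow> reg (sem c s) r = reg s r"
proof (induction c arbitrary: s)
  case (Ins j)
  then show ?case by (cases j) auto
next
  case (For k c)
  have "reg (((\<lambda>s. let s' = sem c (set_reg s 1 (reg s 0 - reg s k))
                    in set_reg s' k (reg s' k + reg s' 3)) ^^ m) s') r = reg s' r" for m s'
    using For by (induction m) (auto simp: Let_def)
  then show ?case using For.prems by simp
qed auto

lemma sem_mem_no_stores: "\<not> stores c \<Longrightarrow> mem (sem c s) = mem s"
proof (induction c arbitrary: s)
  case (Ins j)
  then show ?case by (cases j) auto
next
  case (For k c)
  have "mem (((\<lambda>s. let s' = sem c (set_reg s 1 (reg s 0 - reg s k))
                    in set_reg s' k (reg s' k + reg s' 3)) ^^ m) s') = mem s'" for m s'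
    using For by (induction m) (auto simp: Let_def)
  then show ?case by simp
qed auto

lemma pc_reg_commute: "s\<lparr>reg := f, pc := a\<rparr> = s\<lparr>pc := a, reg := f\<rparr>"
  by simp

lemma written_wf_com:
  assumes "wf_com c"
  shows "written c \<inter> {0, 2, 3} = {}"
  using assms by (induction c) auto

text \<open>An invariant rule for loops. The loop itself changes register 1 and the counter between
  two runs of the body, so the invariant has to be insensitive to both. In return the step may
  assume that the counter is \<open>j\<close> and that unwritten registers keep their initial
  values.\<close>

lemma sem_For_induct:
  fixes I :: "nat \<Rightarrow> config \<Rightarrow> bool"
  assumes wf: "wf_com (For i c)" and one: "reg s 3 = 1"
    and indep: "\<And>j s r x. r = 1 \<or> r = i \<Longrightarrow> I j (set_reg s r x) = I j s"
    and init: "I 0 s"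
    and step: "\<And>j s'. \<lbrakk>j < reg s 0; I j s'; reg s' i = j;
                \<And>r. r \<notin> written (For i c) \<Longrightarrow> reg s' r = reg s r\<rbrakk> \<Longrightarrow> I (Suc j) (sem c s')"
  shows "I (reg s 0) (sem (For i c) s)"
proof -
  let ?f = "\<lambda>s. let s' = sem c (set_reg s 1 (reg s 0 - reg s i))
                    in set_reg s' i (reg s' i + reg s' 3)"
  have unw: "0 \<notin> written c" "3 \<notin> written c" "i \<notin> written c" "3 < i"
    using written_wf_com[of c] wf by auto
  have "I m ((?f ^^ m) (set_reg s i 0)) \<and> reg ((?f ^^ m) (set_reg s i 0)) i = m \<and>
        (\<forall>r. r \<notin> written (For i c) \<longrightarrow> reg ((?f ^^ m) (set_reg s i 0)) r = reg s r)"
    if "m \<le> reg s 0" for m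
    using that
  proof (induction m)
    case 0
    show ?case using init indep[of i 0 s 0] by simp
  next
    case (Suc m)
    define t where "t = (?f ^^ m) (set_reg s i 0)"
    have IH: "I m t" "reg t i = m" "\<And>r. r \<notin> written (For i c) \<Longrightarrow> reg t r = reg s r"
      using Suc unfolding t_def by auto
    define t' where "t' = set_reg t 1 (reg t 0 - reg t i)"
    have t': "I m t'" "reg t' i = m" "\<And>r. r \<notin> written (For i c) \<Longrightarrow> reg t' r = reg s r"
      using IH indep[of 1 m t] unw by (auto simp: t'_def)
    have "I (Suc m) (sem c t')" by (rule step) (use Suc t' in auto)
    then have "I (Suc m) (?f t)"
      using indep[of i] by (simp add: t'_def Let_def)
    moreover have "reg (?f t) i = Suc m"
      using IH unw one by (simp add: Let_def sem_reg_unwritten)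
    moreover have "reg (?f t) r = reg s r" if "r \<notin> written (For i c)" for r
      using that IH by (simp add: Let_def sem_reg_unwritten)
    moreover have iter: "(?f ^^ Suc m) (set_reg s i 0) = ?f t" by (simp add: t_def)
    ultimately show ?case unfolding iter by blast
  qed
  then show ?thesis using indep[of 1] by simp
qed

section \<open>Compilation into machine code and its running time\<close>

fun code_length :: "com \<Rightarrow> nat" where
  "code_length (Ins _) = 1"
| "code_length (c ;; d) = code_length c + code_length d"
| "code_length (IfNZ _ c) = 1 + code_length c"
| "code_length (For _ c) = 5 + code_length c"

fun compile :: "nat \<Rightarrow> com \<Rightarrow> program" where
  "compile a (Ins i) = [i]"
| "compile a (c ;; d) = compile a c @ compile (a + code_length c) d"
| "compile a (IfNZ r c) = JumpZero r (a + 1 + code_length c) # compile (a + 1) c"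
| "compile a (For i c) =
     LoadConst i 0 # Sub 1 0 i # JumpZero 1 (a + 5 + code_length c) #
     compile (a + 3) c @ [Add i i 3, JumpZero 2 (a + 1)]"

lemma length_compile [simp]: "length (compile a c) = code_length c"
  by (induction c arbitrary: a) auto

text \<open>In a loop, 3 pays for the initialisation and the final test (\<open>Sub\<close>,
  \<open>JumpZero\<close>), and 4 for the test, the increment and the jump back in each round;
  \<open>[:0, 1:]\<close> is the input length.\<close>

fun cost :: "com \<Rightarrow> nat poly" where
  "cost (Ins _) = 1"
| "cost (c ;; d) = cost c + cost d"
| "cost (IfNZ _ c) = 1 + cost c"
| "cost (For _ c) = [:3:] + [:0, 1:] * ([:4:] + cost c)"

definition code_at :: "program \<Rightarrow> nat \<Rightarrow> program \<Rightarrow> bool" where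
  "code_at prog a xs \<longleftrightarrow> (\<exists>ys zs. prog = ys @ xs @ zs \<and> length ys = a)"

lemma code_at_append:
  assumes "code_at prog a (xs @ ys)"
  shows "code_at prog a xs" "code_at prog (a + length xs) ys"
proof -
  obtain us vs where *: "prog = us @ (xs @ ys) @ vs" "length us = a"
    using assms unfolding code_at_def by blast
  then have "prog = us @ xs @ (ys @ vs)" "prog = (us @ xs) @ ys @ vs" by auto
  with * show "code_at prog a xs" "code_at prog (a + length xs) ys"
    unfolding code_at_def by (blast, metis length_append)
qed

lemma code_at_Cons:
  assumes "code_at prog a (x # xs)"
  shows "code_at prog (a + 1) xs" "a < length prog" "prog ! a = x"
proof -
  show "code_at prog (a + 1) xs"
    using assms code_at_append(2)[of prog a "[x]" xs] by simp
  show "a < length prog" "prog ! a = x"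
    using assms by (auto simp: code_at_def)
qed

definition reaches :: "program \<Rightarrow> nat \<Rightarrow> config \<Rightarrow> config \<Rightarrow> bool" where
  "reaches prog m s s' \<longleftrightarrow> (\<exists>t\<le>m. (step prog ^^ t) s = s')"

lemma reaches_refl: "reaches prog m s s"
  unfolding reaches_def by (intro exI[of _ 0]) auto

lemma reaches_trans:
  "reaches prog m s s' \<Longrightarrow> reaches prog m' s' s'' \<Longrightarrow> reaches prog (m + m') s s''"
  unfolding reaches_def
  by (metis add.commute add_mono comp_apply funpow_add)

lemma reaches_mono: "reaches prog m s s' \<Longrightarrow> m \<le> m' \<Longrightarrow> reaches prog m' s s'"
  unfolding reaches_def using order.trans[of _ m m'] by blast

lemma reaches_instr:
  "code_at prog a (i # xs) \<Longrightarrow> reaches prog 1 (s\<lparr>pc := a\<rparr>) (exec_instr i (s\<lparr>pc := a\<rparr>))"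
  using code_at_Cons(2,3)[of prog a i xs] unfolding reaches_def
  by (intro exI[of _ 1]) (simp add: step_def halted_def)

text \<open>Induction on the command, with an inner induction over the rounds of a loop. Register 0
  never changes, so one value of the cost polynomial bounds the body in every round.\<close>

lemma reaches_compile:
  "\<lbrakk>wf_com c; code_at prog a (compile a c); reg s 2 = 0; reg s 3 = 1\<rbrakk> \<Longrightarrow>
    reaches prog (poly (cost c) (reg s 0)) (s\<lparr>pc := a\<rparr>) ((sem c s)\<lparr>pc := a + code_length c\<rparr>)"
proof (induction c arbitrary: a s)
  case (Ins i)
  have "exec_instr i (s\<lparr>pc := a\<rparr>) = (sem (Ins i) s)\<lparr>pc := a + 1\<rparr>"
    using Ins by (cases i) auto
  then show ?case using reaches_instr[of prog a i "[]" s] Ins by simp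
next
  case (Seq c d)
  have c: "code_at prog a (compile a c)" "code_at prog (a + code_length c) (compile (a + code_length c) d)"
    using Seq.prems code_at_append[of prog a "compile a c" "compile (a + code_length c) d"] by auto
  have r: "reg (sem c s) r = reg s r" if "r \<in> {0,2,3}" for r
    using that written_wf_com[of c] Seq.prems by (intro sem_reg_unwritten) auto
  show ?case
    using reaches_trans[OF Seq.IH(1)[of a s] Seq.IH(2)[of "a + code_length c" "sem c s"]] Seq.prems c r
    by (simp add: add.assoc)
next
  case (IfNZ r c)
  note code = code_at_Cons[of prog a _ "compile (a + 1) c"]
  have 1: "reaches prog 1 (s\<lparr>pc := a\<rparr>)
      (s\<lparr>pc := if reg s r = 0 then a + 1 + code_length c else a + 1\<rparr>)"
    using reaches_instr[of prog a "JumpZero r (a + 1 + code_length c)" "compile (a + 1) c" s] IfNZ.prems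
    by (cases "reg s r = 0") simp_all
  show ?case
  proof (cases "reg s r = 0")
    case True
    then show ?thesis using 1 by (auto intro: reaches_mono)
  next
    case False
    with 1 have "reaches prog 1 (s\<lparr>pc := a\<rparr>) (s\<lparr>pc := a + 1\<rparr>)" by simp
    from reaches_trans[OF this IfNZ.IH[of "a + 1" s]] show ?thesis
      using IfNZ.prems code False by simp
  qed
next
  case (For i c)
  let ?f = "\<lambda>s. let s' = sem c (set_reg s 1 (reg s 0 - reg s i))
                    in set_reg s' i (reg s' i + reg s' 3)"
  let ?l = "code_length c"
  let ?K = "poly (cost c) (reg s 0)"
  note w = For.prems(1)
  have unw: "0 \<notin> written c" "2 \<notin> written c" "3 \<notin> written c" "i \<notin> written c" "3 < i"
    using written_wf_com[of c] w by auto
  have p0: "code_at prog a (LoadConst i 0 # Sub 1 0 i # JumpZero 1 (a + 5 + ?l) #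
     compile (a + 3) c @ [Add i i 3, JumpZero 2 (a + 1)])"
    using For.prems by simp
  note p1 = code_at_Cons(1)[OF p0]
  note p2 = code_at_Cons(1)[OF p1]
  note p3 = code_at_Cons(1)[OF p2]
  have p4: "code_at prog (a + 3 + ?l) [Add i i 3, JumpZero 2 (a + 1)]" and
       pc: "code_at prog (a + 3) (compile (a + 3) c)"
    using code_at_append[OF p3] by (simp_all add: numeral_eq_Suc)
  have p5: "code_at prog (a + 4 + ?l) [JumpZero 2 (a + 1)]"
    using code_at_Cons(1)[OF p4] by (simp add: numeral_eq_Suc)
  have iter: "reaches prog (?K + 4) (t\<lparr>pc := a + 1\<rparr>) ((?f t)\<lparr>pc := a + 1\<rparr>)"
    if t: "reg t i < reg t 0" "reg t 0 = reg s 0" "reg t 2 = 0" "reg t 3 = 1" for t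
  proof -
    define t1 where "t1 = set_reg t 1 (reg t 0 - reg t i)"
    have 1: "reaches prog 1 (t\<lparr>pc := a + 1\<rparr>) (t1\<lparr>pc := a + 2\<rparr>)"
      using reaches_instr[OF p1, of "t"] by (simp add: t1_def set_reg_def pc_reg_commute)
    have 2: "reaches prog 1 (t1\<lparr>pc := a + 2\<rparr>) (t1\<lparr>pc := a + 3\<rparr>)"
      using reaches_instr[OF p2, of "t1"] t by (simp add: t1_def numeral_eq_Suc set_reg_def pc_reg_commute)
    have 3: "reaches prog ?K (t1\<lparr>pc := a + 3\<rparr>) ((sem c t1)\<lparr>pc := a + 3 + ?l\<rparr>)"
      using For.IH[OF _ pc, of t1] t w by (simp add: t1_def)
    have u: "reg (sem c t1) r = reg t r" if "r \<in> {0,2,3,i}" for r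
      using that unw by (subst sem_reg_unwritten) (auto simp: t1_def)
    have 4: "reaches prog 1 ((sem c t1)\<lparr>pc := a + 3 + ?l\<rparr>) ((?f t)\<lparr>pc := a + 4 + ?l\<rparr>)"
      using reaches_instr[OF p4, of "(sem c t1)"]
      by (simp add: Let_def t1_def numeral_eq_Suc set_reg_def pc_reg_commute)
    \<comment> \<open>Register 2 holds 0, which makes \<open>JumpZero 2\<close> an unconditional
      jump.\<close>
    have 5: "reaches prog 1 ((?f t)\<lparr>pc := a + 4 + ?l\<rparr>) ((?f t)\<lparr>pc := a + 1\<rparr>)"
    proof -
      have "reg (?f t) 2 = 0"
        using u[of 2] t unw by (auto simp: Let_def t1_def)
      then show ?thesis
        using reaches_instr[OF p5, of "?f t"] by (simp del: One_nat_def)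
    qed
    show ?thesis
      using reaches_trans[OF 1 reaches_trans[OF 2 reaches_trans[OF 3 reaches_trans[OF 4 5]]]]
      by (rule reaches_mono) simp
  qed
  let ?s0 = "set_reg s i 0"
  have loop: "reaches prog (m * (?K + 4)) (?s0\<lparr>pc := a + 1\<rparr>) (((?f ^^ m) ?s0)\<lparr>pc := a + 1\<rparr>) \<and>
      reg ((?f ^^ m) ?s0) i = m \<and>
      (\<forall>r \<in> {0,2,3}. reg ((?f ^^ m) ?s0) r = reg s r)" if "m \<le> reg s 0" for m
    using that
  proof (induction m)
    case 0
    then show ?case using unw by (auto intro: reaches_refl)
  next
    case (Suc m)
    define t where "t = (?f ^^ m) ?s0"
    have IH: "reaches prog (m * (?K + 4)) (?s0\<lparr>pc := a + 1\<rparr>) (t\<lparr>pc := a + 1\<rparr>)"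
      "reg t i = m" "reg t 0 = reg s 0" "reg t 2 = 0" "reg t 3 = 1"
      using Suc For.prems unfolding t_def by auto
    have "reaches prog (?K + 4) (t\<lparr>pc := a + 1\<rparr>) ((?f t)\<lparr>pc := a + 1\<rparr>)"
      by (rule iter) (use IH Suc.prems in auto)
    from reaches_trans[OF IH(1) this]
    have "reaches prog (Suc m * (?K + 4)) (?s0\<lparr>pc := a + 1\<rparr>) ((?f t)\<lparr>pc := a + 1\<rparr>)"
      by (simp only: mult_Suc add.commute)
    moreover have "reg (?f t) i = Suc m" "\<forall>r \<in> {0,2,3}. reg (?f t) r = reg s r"
      using IH unw For.prems by (auto simp: Let_def sem_reg_unwritten)
    moreover have iter: "(?f ^^ Suc m) ?s0 = ?f t" by (simp add: t_def)
    ultimately show ?case unfolding iter by blast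
  qed
  define t where "t = (?f ^^ reg s 0) ?s0"
  have t: "reaches prog (reg s 0 * (?K + 4)) (?s0\<lparr>pc := a + 1\<rparr>) (t\<lparr>pc := a + 1\<rparr>)"
    "reg t i = reg s 0" "reg t 0 = reg s 0"
    using loop[of "reg s 0"] unfolding t_def by auto
  have 1: "reaches prog 1 (s\<lparr>pc := a\<rparr>) (?s0\<lparr>pc := a + 1\<rparr>)"
    using reaches_instr[OF p0, of "s"] by (simp add: set_reg_def pc_reg_commute)
  have 2: "reaches prog 1 (t\<lparr>pc := a + 1\<rparr>) ((set_reg t 1 0)\<lparr>pc := a + 2\<rparr>)"
    using reaches_instr[OF p1, of "t"] t by (simp add: set_reg_def pc_reg_commute)
  have 3: "reaches prog 1 ((set_reg t 1 0)\<lparr>pc := a + 2\<rparr>) ((set_reg t 1 0)\<lparr>pc := a + 5 + ?l\<rparr>)"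
    using reaches_instr[OF p2, of "(set_reg t 1 0)"] by (simp add: numeral_eq_Suc set_reg_def pc_reg_commute)
  have sem: "sem (For i c) s = set_reg t 1 0"
    unfolding t_def by simp
  have "reaches prog (1 + (reg s 0 * (?K + 4) + (1 + 1))) (s\<lparr>pc := a\<rparr>)
      ((sem (For i c) s)\<lparr>pc := a + 5 + ?l\<rparr>)"
    unfolding sem by (rule reaches_trans[OF 1 reaches_trans[OF t(1) reaches_trans[OF 2 3]]])
  then have "reaches prog (poly (cost (For i c)) (reg s 0)) (s\<lparr>pc := a\<rparr>)
      ((sem (For i c) s)\<lparr>pc := a + 5 + ?l\<rparr>)"
    by (rule reaches_mono) (simp add: algebra_simps)
  then show ?case by (simp only: code_length.simps add.assoc)
qed

lemma funpow_step_halted: "halted prog s \<Longrightarrow> (step prog ^^ t) s = s"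
  by (induction t) (auto simp: step_def)

lemma reaches_halted:
  assumes "reaches prog m s s'" "halted prog s'"
  shows "(step prog ^^ m) s = s'"
proof -
  obtain t where "t \<le> m" "(step prog ^^ t) s = s'"
    using assms unfolding reaches_def by blast
  then show ?thesis
    using funpow_add[of "m - t" t "step prog"] funpow_step_halted[OF assms(2)] by auto
qed

text \<open>Only the last instruction, which sets the output length, overwrites register 0.\<close>

definition run :: "com \<Rightarrow> nat \<Rightarrow> bool list \<Rightarrow> nat list" where
  "run c r w = (let s = sem c (set_reg (init_config w) 3 1) in map (mem s) [0..<reg s r])"

lemma polynomial_time_run:
  assumes "wf_com c"
  shows "polynomial_time (run c r)"
proof -
  \<comment> \<open>Adding register 2, which is 0, copies register \<open>r\<close> to register 0.
    The two instructions around the compiled code account for \<open>[:2:]\<close>.\<close>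
  define prog where "prog = LoadConst 3 1 # compile 1 c @ [Add 0 r 2]"
  let ?p = "[:2:] + cost c"
  have "halted prog ((step prog ^^ poly ?p (length w)) (init_config w)) \<and>
     output_word ((step prog ^^ poly ?p (length w)) (init_config w)) = run c r w" for w
  proof -
    define s where "s = set_reg (init_config w) 3 1"
    have 1: "reaches prog 1 (init_config w) (s\<lparr>pc := 1\<rparr>)"
      using reaches_instr[of prog 0 "LoadConst 3 1" "compile 1 c @ [Add 0 r 2]" "init_config w"]
      by (simp add: s_def init_config_def prog_def code_at_def set_reg_def)
    have at: "code_at prog 1 (compile 1 c @ [Add 0 r 2])"
    proof -
      have "code_at prog 0 (LoadConst 3 1 # compile 1 c @ [Add 0 r 2])"
        by (simp add: prog_def code_at_def)
      from code_at_Cons(1)[OF this] show ?thesis by simp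
    qed
    have 2: "reaches prog (poly (cost c) (reg s 0)) (s\<lparr>pc := 1\<rparr>) ((sem c s)\<lparr>pc := 1 + code_length c\<rparr>)"
      by (rule reaches_compile)
         (use assms code_at_append(1)[OF at] in \<open>auto simp: s_def init_config_def\<close>)
    define s' where "s' = exec_instr (Add 0 r 2) ((sem c s)\<lparr>pc := 1 + code_length c\<rparr>)"
    have 3: "reaches prog 1 ((sem c s)\<lparr>pc := 1 + code_length c\<rparr>) s'"
      unfolding s'_def
      by (rule reaches_instr) (use code_at_append(2)[OF at] in simp)
    have halt: "halted prog s'"
      by (simp add: s'_def halted_def prog_def)
    have "reaches prog (poly ?p (length w)) (init_config w) s'"
      using reaches_trans[OF 1 reaches_trans[OF 2 3]]
      by (rule reaches_mono) (simp add: s_def init_config_def)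
    then have "(step prog ^^ poly ?p (length w)) (init_config w) = s'"
      using halt by (rule reaches_halted)
    moreover have "reg (sem c s) 2 = 0"
      using written_wf_com[OF assms] by (subst sem_reg_unwritten) (auto simp: s_def init_config_def)
    then have "output_word s' = run c r w"
      by (simp add: s'_def output_word_def run_def Let_def s_def)
    ultimately show ?thesis using halt by simp
  qed
  then show ?thesis
    unfolding polynomial_time_def Let_def by blast
qed

section \<open>The recovery program\<close>

text \<open>
  Register 4 holds \<open>n\<close>, register 8 the number \<open>32 n \<lceil>log\<^sub>2 n\<rceil>\<close>
  and register 9 its square root, the threshold. Registers 11, 12, 13 are the loop counters
  \<open>u\<close>, \<open>v\<close>, \<open>w\<close>; registers 14 and 15 hold the addresses \<open>u n\<close> and
  \<open>v n\<close> of the rows to be compared, and register 20 counts their agreements. The label of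
  \<open>x\<close> is kept at address \<open>n\<^sup>2 + x\<close>, behind the adjacency matrix.
\<close>

lemma sem_Ins [simp]:
  "sem (Ins (LoadConst i c)) s = set_reg s i c"
  "sem (Ins (Add i j l)) s = set_reg s i (reg s j + reg s l)"
  "sem (Ins (Sub i j l)) s = set_reg s i (reg s j - reg s l)"
  "sem (Ins (Load i j)) s = set_reg s i (mem s (reg s j))"
  "sem (Ins (Store i j)) s = s\<lparr>mem := (mem s)(reg s i := reg s j)\<rparr>"
  by (simp_all add: set_reg_def)

declare sem.simps(1,4) [simp del]

section \<open>Square roots and logarithms by additions\<close>

definition ceil_sqrt :: "nat \<Rightarrow> nat" where
  "ceil_sqrt m = (LEAST t. m \<le> t * t)"

lemma less_ceil_sqrt_iff: "t < ceil_sqrt m \<longleftrightarrow> t * t < m"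
proof -
  have "m \<le> ceil_sqrt m * ceil_sqrt m"
    unfolding ceil_sqrt_def by (rule LeastI[of _ m]) simp
  moreover have "m \<le> t * t" if "ceil_sqrt m \<le> t"
    using that calculation mult_le_mono le_trans by blast
  moreover have "ceil_sqrt m \<le> t" if "m \<le> t * t"
    unfolding ceil_sqrt_def by (rule Least_le) (fact that)
  ultimately show ?thesis by (meson not_le)
qed

lemma ceil_sqrt_square [simp]: "ceil_sqrt (n * n) = n"
  using less_ceil_sqrt_iff[of n "n * n"] less_ceil_sqrt_iff[of "ceil_sqrt (n * n)" "n * n"]
  by (metis less_irrefl linorder_neqE_nat mult_strict_mono' zero_le)

definition ceil_log2 :: "nat \<Rightarrow> nat" where
  "ceil_log2 m = (LEAST l. m \<le> 2 ^ l)"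

lemma less_ceil_log2_iff: "l < ceil_log2 m \<longleftrightarrow> 2 ^ l < m"
proof -
  have "m \<le> 2 ^ ceil_log2 m"
    unfolding ceil_log2_def by (rule LeastI[of _ m]) simp
  moreover have "m \<le> 2 ^ l" if "ceil_log2 m \<le> l"
    using that calculation power_increasing[of "ceil_log2 m" l "2::nat"] by linarith
  moreover have "ceil_log2 m \<le> l" if "m \<le> 2 ^ l"
    unfolding ceil_log2_def by (rule Least_le) (fact that)
  ultimately show ?thesis by (meson not_le)
qed

lemma ceil_log2_le: "ceil_log2 m \<le> m"
  using less_ceil_log2_iff[of m m] less_exp[of m] by linarith

text \<open>Register \<open>sq\<close> follows the square of \<open>dst\<close> through
  \<open>(d + 1)^2 = d^2 + 2 d + 1\<close>; both stop moving once the square reaches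
  \<open>src\<close>.\<close>

definition sqrt_com :: "nat \<Rightarrow> nat \<Rightarrow> nat \<Rightarrow> com" where
  "sqrt_com src dst sq =
     For 11 (Ins (Sub 5 src sq) ;;
       IfNZ 5 (Ins (Add sq sq dst) ;; Ins (Add sq sq dst) ;; Ins (Add sq sq 3) ;; Ins (Add dst dst 3)))"

lemma sem_sqrt_com:
  assumes "reg s 3 = 1" "reg s dst = 0" "reg s sq = 0" "src \<notin> {1, dst, sq, 5, 11}"
    "dst \<notin> {sq, 5, 11}" "3 < dst" "sq \<notin> {5, 11}" "3 < sq"
  shows "reg (sem (sqrt_com src dst sq) s) dst = min (reg s 0) (ceil_sqrt (reg s src))"
proof -
  let ?I = "\<lambda>j s'. reg s' dst = min j (ceil_sqrt (reg s src)) \<and> reg s' sq = reg s' dst * reg s' dst"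
  have "?I (reg s 0) (sem (sqrt_com src dst sq) s)"
    unfolding sqrt_com_def
  proof (rule sem_For_induct, goal_cases)
    case (5 j s')
    have u: "reg s' src = reg s src" "reg s' 3 = 1"
      using 5(4)[of src] 5(4)[of 3] assms by auto
    show ?case
    proof (cases "j < ceil_sqrt (reg s src)")
      case True
      then show ?thesis
        using 5(2) u assms less_ceil_sqrt_iff[of j "reg s src"] by (auto simp: min_def)
    next
      case False
      then have "min (Suc j) (ceil_sqrt (reg s src)) = min j (ceil_sqrt (reg s src))"
        "min j (ceil_sqrt (reg s src)) = ceil_sqrt (reg s src)" by auto
      then show ?thesis
        using 5(2) u assms less_ceil_sqrt_iff[of "ceil_sqrt (reg s src)" "reg s src"] by auto
    qed
  qed (use assms in auto)
  then show ?thesis by blast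
qed

text \<open>Each doubling of register 7 comes with one addition of \<open>n\<close> to register 8,
  which yields the product of \<open>n\<close> with the logarithm.\<close>

definition log_com :: com where
  "log_com = Ins (LoadConst 7 1) ;;
     For 11 (Ins (Sub 5 4 7) ;; IfNZ 5 (Ins (Add 7 7 7) ;; Ins (Add 8 8 4)))"

lemma sem_log_com:
  assumes "reg s 3 = 1" "reg s 8 = 0" "reg s 4 \<le> reg s 0"
  shows "reg (sem log_com s) 8 = reg s 4 * ceil_log2 (reg s 4)"
proof -
  let ?n = "reg s 4"
  let ?I = "\<lambda>j s'. reg s' 7 = 2 ^ min j (ceil_log2 ?n) \<and> reg s' 8 = ?n * min j (ceil_log2 ?n)"
  let ?s = "set_reg s 7 1"
  let ?c = "For 11 (Ins (Sub 5 4 7) ;; IfNZ 5 (Ins (Add 7 7 7) ;; Ins (Add 8 8 4)))"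
  have "?I (reg ?s 0) (sem ?c ?s)"
  proof (rule sem_For_induct, goal_cases)
    case (5 j s')
    have u: "reg s' 4 = reg s 4"
      using 5(4)[of 4] by auto
    show ?case
      using 5 u less_ceil_log2_iff[of j ?n] less_ceil_log2_iff[of "ceil_log2 ?n" ?n]
      by (auto simp: min_def algebra_simps)
  qed (use assms in auto)
  \<comment> \<open>The number of rounds, the input length, exceeds the number of doublings needed,
    so the minimum in the invariant disappears.\<close>
  moreover have "ceil_log2 ?n \<le> reg ?s 0"
    using ceil_log2_le[of ?n] assms by simp
  ultimately show ?thesis by (simp add: log_com_def)
qed

section \<open>Comparing rows and labelling vertices\<close>

text \<open>With truncated subtraction, \<open>(a - b) + (b - a)\<close> is the distance of
  \<open>a\<close> and \<open>b\<close>, and 1 minus it indicates equality. The test of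
  \<open>n - w\<close> idles the rounds beyond \<open>n\<close>, since every loop has as many rounds
  as the input has bits.\<close>

definition agree_com :: com where
  "agree_com = Ins (LoadConst 20 0) ;;
     For 13 (Ins (Sub 5 4 13) ;;
       IfNZ 5 (Ins (Add 16 14 13) ;; Ins (Load 17 16) ;; Ins (Add 16 15 13) ;; Ins (Load 18 16) ;;
         Ins (Sub 19 17 18) ;; Ins (Sub 18 18 17) ;; Ins (Add 19 19 18) ;; Ins (Sub 19 3 19) ;;
         Ins (Add 20 20 19)))"

lemma written_agree_com: "written agree_com = {1, 5, 13, 16, 17, 18, 19, 20}"
  by (auto simp: agree_com_def)

lemma stores_agree_com: "\<not> stores agree_com"
  by (auto simp: agree_com_def)

lemma sem_agree_com:
  assumes "reg s 3 = 1" "reg s 4 \<le> reg s 0"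
  shows "reg (sem agree_com s) 20 =
    card {w. w < reg s 4 \<and> mem s (reg s 14 + w) = mem s (reg s 15 + w)}"
proof -
  let ?n = "reg s 4"
  let ?A = "\<lambda>j. {w. w < min j ?n \<and> mem s (reg s 14 + w) = mem s (reg s 15 + w)}"
  let ?I = "\<lambda>j s'. reg s' 20 = card (?A j) \<and> mem s' = mem s"
  let ?s = "set_reg s 20 0"
  have "?I (reg ?s 0) (sem (For 13 (Ins (Sub 5 4 13) ;;
       IfNZ 5 (Ins (Add 16 14 13) ;; Ins (Load 17 16) ;; Ins (Add 16 15 13) ;; Ins (Load 18 16) ;;
         Ins (Sub 19 17 18) ;; Ins (Sub 18 18 17) ;; Ins (Add 19 19 18) ;; Ins (Sub 19 3 19) ;;
         Ins (Add 20 20 19)))) ?s)"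
  proof (rule sem_For_induct, goal_cases)
    case (5 j s')
    have u: "reg s' 3 = 1" "reg s' 4 = reg s 4" "reg s' 14 = reg s 14" "reg s' 15 = reg s 15"
      using 5(4)[of 3] 5(4)[of 4] 5(4)[of 14] 5(4)[of 15] assms by auto
    show ?case
    proof (cases "j < ?n")
      case True
      then have A: "?A (Suc j) = (if mem s (reg s 14 + j) = mem s (reg s 15 + j)
          then insert j (?A j) else ?A j)"
        by (auto simp: less_Suc_eq)
      have c: "card (?A (Suc j)) = card (?A j) + 
         (Suc 0 - (mem s (reg s 14 + j) - mem s (reg s 15 + j) + (mem s (reg s 15 + j) - mem s (reg s 14 + j))))"
        unfolding A by auto
      show ?thesis unfolding c
        using 5 u True by simp
    next
      case False
      then have "min (Suc j) ?n = min j ?n" by auto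
      then show ?thesis using 5 u False by simp
    qed
  qed (use assms in auto)
  then show ?thesis using assms by (simp add: agree_com_def min_absorb2)
qed

text \<open>The compared number is agreements minus disagreements; truncation at 0 is harmless for
  \<open>t > 0\<close>. The entry type is left open so that memory words and input bits can both be
  compared.\<close>

definition similar :: "nat \<Rightarrow> nat \<Rightarrow> (nat \<Rightarrow> 'a) \<Rightarrow> nat \<Rightarrow> nat \<Rightarrow> bool" where
  "similar n t m u v \<longleftrightarrow> t \<le> 2 * card {w. w < n \<and> m (u * n + w) = m (v * n + w)} - n"

lemma row_address: "u < n \<Longrightarrow> w < n \<Longrightarrow> u * n + w < n * (n::nat)"
  by (metis add_less_cancel_left less_le_trans mult_Suc mult_le_mono1 Suc_leI add.commute)

lemma similar_cong:
  assumes "\<And>x. x < n * n \<Longrightarrow> m x = m' x" "u < n" "v < n"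
  shows "similar n t m u v = similar n t m' u v"
proof -
  have "{w. w < n \<and> m (u * n + w) = m (v * n + w)} = {w. w < n \<and> m' (u * n + w) = m' (v * n + w)}"
    using assms row_address by auto
  then show ?thesis by (simp add: similar_def)
qed

text \<open>Adding 1 before subtracting the threshold turns the non-strict comparison into a test
  for a nonzero register. Only \<open>v < u\<close> is compared, and both vertices then receive the
  label \<open>u + 1\<close>.\<close>

definition row_com :: com where
  "row_com = Ins (LoadConst 15 0) ;;
     For 12 (Ins (Sub 5 11 12) ;;
       IfNZ 5 (agree_com ;;
         Ins (Add 20 20 20) ;; Ins (Sub 20 20 4) ;; Ins (Add 20 20 3) ;; Ins (Sub 20 20 9) ;;
         Ins (Add 17 11 3) ;;
         IfNZ 20 (Ins (Add 16 0 12) ;; Ins (Store 16 17) ;; Ins (Add 16 0 11) ;; Ins (Store 16 17))) ;;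
       Ins (Add 15 15 4))"

lemma written_row_com: "written row_com = {1, 5, 12, 13, 15, 16, 17, 18, 19, 20}"
  by (auto simp: row_com_def written_agree_com)

lemma wf_agree_com: "wf_com agree_com"
  by (simp add: agree_com_def)

lemma wf_row_com: "wf_com row_com"
  by (simp add: row_com_def wf_agree_com written_agree_com)

text \<open>
  The vertices that receive the label \<open>u + 1\<close> in pass \<open>u\<close>, after comparison with the first
  \<open>j\<close> vertices. Later passes overwrite, so a clique \<open>C\<close> ends up with the label \<open>Max C + 1\<close>.
\<close>

definition marked :: "(nat \<Rightarrow> nat \<Rightarrow> bool) \<Rightarrow> nat \<Rightarrow> nat \<Rightarrow> nat \<Rightarrow> bool" where
  "marked R u j x \<longleftrightarrow> x < j \<and> R u x \<or> x = u \<and> (\<exists>y<j. R u y)"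

lemma sem_row_com:
  fixes s :: config
  defines "N \<equiv> reg s 0" and "u \<equiv> reg s 11" and "n \<equiv> reg s 4"
  defines "R \<equiv> similar n (reg s 9) (mem s)"
  assumes "reg s 3 = 1" "N = n * n" "reg s 14 = u * n" "u < n"
  shows "(\<forall>x<N. mem (sem row_com s) x = mem s x) \<and>
     (\<forall>x. mem (sem row_com s) (N + x) = (if marked R u u x then Suc u else mem s (N + x)))"
proof -
  let ?I = "\<lambda>j s'. reg s' 15 = j * n \<and> (\<forall>x<N. mem s' x = mem s x) \<and>
     (\<forall>x. mem s' (N + x) = (if marked R u (min j u) x then Suc u else mem s (N + x)))"
  let ?s = "set_reg s 15 0"
  let ?body = "Ins (Sub 5 11 12) ;;
       IfNZ 5 (agree_com ;;
         Ins (Add 20 20 20) ;; Ins (Sub 20 20 4) ;; Ins (Add 20 20 3) ;; Ins (Sub 20 20 9) ;;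
         Ins (Add 17 11 3) ;;
         IfNZ 20 (Ins (Add 16 0 12) ;; Ins (Store 16 17) ;; Ins (Add 16 0 11) ;; Ins (Store 16 17))) ;;
       Ins (Add 15 15 4)"
  have "?I (reg ?s 0) (sem (For 12 ?body) ?s)"
  proof (rule sem_For_induct, goal_cases)
    case (5 j s')
    have u: "reg s' 0 = N" "reg s' 3 = 1" "reg s' 4 = n" "reg s' 9 = reg s 9" "reg s' 11 = u"
        "reg s' 12 = j" "reg s' 14 = u * n" "reg s' 15 = j * n"
      using 5(2,3) 5(4)[of 0] 5(4)[of 3] 5(4)[of 4] 5(4)[of 9] 5(4)[of 11] 5(4)[of 14] assms
      by (auto simp: written_agree_com)
    show ?case
    proof (cases "j < u")
      case False
      then have "min (Suc j) u = min j u" by auto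
      then show ?thesis using 5(2) False u by simp
    next
      case True
      define t where "t = sem agree_com (set_reg s' 5 (u - j))"
      have t: "reg t r = reg s' r" if "r \<in> {0,3,4,9,11,12,14,15}" for r
        using that unfolding t_def by (subst sem_reg_unwritten) (auto simp: written_agree_com)
      have mt: "mem t = mem s'"
        unfolding t_def by (subst sem_mem_no_stores) (auto simp: stores_agree_com)
      have t20: "reg t 20 = card {w. w < n \<and> mem s' (u * n + w) = mem s' (j * n + w)}"
        unfolding t_def using u \<open>N = n * n\<close> by (subst sem_agree_com) auto
      \<comment> \<open>The labels written so far lie behind the matrix, and similarity reads only
        the matrix.\<close>
      have "R u j \<longleftrightarrow> similar n (reg s 9) (mem s') u j"
        unfolding R_def by (rule similar_cong) (use 5(2) True assms in auto)
      then have R: "R u j \<longleftrightarrow> reg t 20 + reg t 20 - n + 1 - reg s 9 \<noteq> 0"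
        unfolding similar_def t20[symmetric] by auto
      have mark: "marked R u (Suc j) x \<longleftrightarrow> marked R u j x \<or> (R u j \<and> (x = j \<or> x = u))" for x
        by (auto simp: marked_def less_Suc_eq)
      have min: "min (Suc j) u = Suc j" "min j u = j" using True by auto
      have eq: "set_reg s' 5 (reg s' 11 - reg s' 12) = set_reg s' 5 (u - j)"
        using u by simp
      have "reg (sem ?body s') 15 = Suc j * n"
        using True by (simp add: eq u t flip: t_def)
      moreover have "mem (sem ?body s') =
          (if R u j then (mem s')(N + j := Suc u, N + u := Suc u) else mem s')"
        unfolding R using True by (simp add: eq u t mt flip: t_def)
      ultimately show ?thesis
        unfolding min mark using 5(2) True by (auto simp: min)
    qed
  qed (use assms wf_row_com in \<open>auto simp: marked_def row_com_def\<close>)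
  moreover have "min N u = u"
    using assms by (metis min_absorb2 le_square le_trans less_imp_le_nat)
  ultimately show ?thesis
    by (simp add: row_com_def flip: N_def)
qed

text \<open>One plus the last pass that marks \<open>x\<close>, or 0 if no pass does.\<close>

primrec label :: "(nat \<Rightarrow> nat \<Rightarrow> bool) \<Rightarrow> nat \<Rightarrow> nat \<Rightarrow> nat" where
  "label R 0 x = 0"
| "label R (Suc u) x = (if marked R u u x then Suc u else label R u x)"

lemma marked_cong:
  "(\<And>v. v < u \<Longrightarrow> R u v = R' u v) \<Longrightarrow> marked R u u x = marked R' u u x"
  by (auto simp: marked_def)

definition label_com :: com where
  "label_com = Ins (LoadConst 14 0) ;;
     For 11 (Ins (Sub 5 4 11) ;; IfNZ 5 (row_com ;; Ins (Add 14 14 4)))"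

lemma sem_label_com:
  fixes s :: config
  defines "N \<equiv> reg s 0" and "n \<equiv> reg s 4"
  defines "R \<equiv> similar n (reg s 9) (mem s)"
  assumes "reg s 3 = 1" "N = n * n" "\<And>x. N \<le> x \<Longrightarrow> mem s x = 0"
  shows "mem (sem label_com s) (N + x) = label R n x"
proof -
  let ?I = "\<lambda>j s'. reg s' 14 = min j n * n \<and> (\<forall>x<N. mem s' x = mem s x) \<and>
     (\<forall>x. mem s' (N + x) = label R (min j n) x)"
  let ?s = "set_reg s 14 0"
  let ?body = "Ins (Sub 5 4 11) ;; IfNZ 5 (row_com ;; Ins (Add 14 14 4))"
  have "?I (reg ?s 0) (sem (For 11 ?body) ?s)"
  proof (rule sem_For_induct, goal_cases)
    case (5 j s')
    have u: "reg s' 0 = N" "reg s' 3 = 1" "reg s' 4 = n" "reg s' 9 = reg s 9" "reg s' 11 = j"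
      using 5(2,3) 5(4)[of 0] 5(4)[of 3] 5(4)[of 4] 5(4)[of 9] assms
      by (auto simp: written_row_com)
    show ?case
    proof (cases "j < n")
      case False
      then have "min (Suc j) n = min j n" by auto
      then show ?thesis using 5(2) False u by simp
    next
      case True
      define t where "t = set_reg s' 5 (n - j)"
      have t: "reg t 0 = N" "reg t 3 = 1" "reg t 4 = n" "reg t 9 = reg s 9" "reg t 11 = j"
          "reg t 14 = j * n" "reg t 5 = n - j" "mem t = mem s'"
        using u 5(2) True by (auto simp: t_def)
      have "similar n (reg s 9) (mem s') j v = R j v" if "v < j" for v
        unfolding R_def by (rule similar_cong) (use 5(2) True that assms in auto)
      then have m: "marked (similar n (reg s 9) (mem s')) j j x = marked R j j x" for x
        by (rule marked_cong)
      have row: "(\<forall>x<N. mem (sem row_com t) x = mem s' x) \<and>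
         (\<forall>x. mem (sem row_com t) (N + x) = (if marked R j j x then Suc j else mem s' (N + x)))"
        using sem_row_com[of t] t \<open>N = n * n\<close> True by (simp add: m)
      have min: "min (Suc j) n = Suc j" "min j n = j" using True by auto
      have "reg (sem row_com t) r = reg t r" if "r \<in> {4, 14}" for r
        using that by (subst sem_reg_unwritten) (auto simp: written_row_com)
      then have "reg (sem ?body s') 14 = Suc j * n"
        using True by (simp add: u t flip: t_def)
      moreover have "mem (sem ?body s') = mem (sem row_com t)"
        using True by (simp add: u t flip: t_def)
      ultimately show ?thesis
        unfolding min using 5(2) row by (simp add: min)
    qed
  qed (use assms wf_row_com in \<open>auto simp: written_row_com\<close>)
  moreover have "min N n = n"
    using assms by (metis min_absorb2 le_square)
  ultimately show ?thesis
    by (simp add: label_com_def flip: N_def)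
qed

text \<open>Outputs are read from address 0 on, so the labels are moved over the matrix. Because
  \<open>n \<le> n * n\<close>, no label is overwritten before it is read.\<close>

definition copy_com :: com where
  "copy_com = For 11 (Ins (Sub 5 4 11) ;;
     IfNZ 5 (Ins (Add 16 0 11) ;; Ins (Load 17 16) ;; Ins (Store 11 17)))"

lemma sem_copy_com:
  assumes "reg s 3 = 1" "reg s 4 \<le> reg s 0" "x < reg s 4"
  shows "mem (sem copy_com s) x = mem s (reg s 0 + x)"
proof -
  define N where "N = reg s 0"
  let ?n = "reg s 4"
  let ?I = "\<lambda>j s'. \<forall>x. mem s' x = (if x < min j ?n then mem s (N + x) else mem s x)"
  have "?I (reg s 0) (sem copy_com s)"
    unfolding copy_com_def
  proof (rule sem_For_induct, goal_cases)
    case (5 j s')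
    have u: "reg s' 4 = ?n" "reg s' 0 = N" "?n \<le> N"
      using 5(4)[of 4] 5(4)[of 0] assms by (auto simp: N_def)
    show ?case
    proof (cases "j < ?n")
      case True
      then have "min (Suc j) ?n = Suc j" "min j ?n = j" by auto
      with True show ?thesis using 5(1-3) u by (auto simp: less_Suc_eq)
    next
      case False
      then have "min (Suc j) ?n = min j ?n" by auto
      with False show ?thesis using 5(2,3) u by simp
    qed
  qed (use assms in auto)
  then show ?thesis using assms by (simp add: N_def)
qed

definition recovery_com :: com where
  "recovery_com =
     sqrt_com 0 4 6 ;; log_com ;;
     Ins (Add 8 8 8) ;; Ins (Add 8 8 8) ;; Ins (Add 8 8 8) ;; Ins (Add 8 8 8) ;; Ins (Add 8 8 8) ;;
     sqrt_com 8 9 10 ;; label_com ;; copy_com"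

lemma wf_recovery_com: "wf_com recovery_com"
  by (simp add: recovery_com_def sqrt_com_def log_com_def label_com_def copy_com_def
      wf_row_com written_row_com)

text \<open>The minimum is what the square root loop computes, as it can count no further than its
  \<open>n * n\<close> rounds. \<open>threshold_lower\<close> covers both cases.\<close>

definition threshold :: "nat \<Rightarrow> nat" where
  "threshold n = min (n * n) (ceil_sqrt (32 * (n * ceil_log2 n)))"

lemma run_recovery_com:
  assumes "length w = n * n"
  shows "run recovery_com 4 w =
    map (label (similar n (threshold n) (\<lambda>x. x < n * n \<and> w ! x)) n) [0..<n]"
proof -
  define s0 where "s0 = set_reg (init_config w) 3 1"
  define s1 where "s1 = sem (sqrt_com 0 4 6) s0"
  define s2 where "s2 = sem log_com s1"
  define s3 where "s3 = sem (Ins (Add 8 8 8) ;; Ins (Add 8 8 8) ;; Ins (Add 8 8 8) ;;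
     Ins (Add 8 8 8) ;; Ins (Add 8 8 8)) s2"
  define s4 where "s4 = sem (sqrt_com 8 9 10) s3"
  define s5 where "s5 = sem label_com s4"
  define s6 where "s6 = sem copy_com s5"
  have s6: "sem recovery_com s0 = s6"
    by (simp add: recovery_com_def s1_def s2_def s3_def s4_def s5_def s6_def)
  have n: "n \<le> n * n" by simp
  have r1: "reg s1 r = reg s0 r" if "r \<notin> {1,4,5,6,11}" for r
    using that unfolding s1_def by (subst sem_reg_unwritten) (auto simp: sqrt_com_def)
  have r2: "reg s2 r = reg s1 r" if "r \<notin> {1,5,7,8,11}" for r
    using that unfolding s2_def by (subst sem_reg_unwritten) (auto simp: log_com_def)
  have r3: "reg s3 r = reg s2 r" if "r \<noteq> 8" for r
    using that unfolding s3_def by (subst sem_reg_unwritten) auto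
  have r4: "reg s4 r = reg s3 r" if "r \<notin> {1,5,9,10,11}" for r
    using that unfolding s4_def by (subst sem_reg_unwritten) (auto simp: sqrt_com_def)
  have r5: "reg s5 r = reg s4 r" if "r \<in> {0,3,4}" for r
    using that unfolding s5_def by (subst sem_reg_unwritten) (auto simp: label_com_def written_row_com)
  have r6: "reg s6 4 = reg s5 4"
    unfolding s6_def by (subst sem_reg_unwritten) (auto simp: copy_com_def)
  have m: "mem s4 = mem s0"
    unfolding s4_def s3_def s2_def s1_def
    by (subst sem_mem_no_stores, simp add: sqrt_com_def log_com_def)+ simp
  have i: "reg s0 0 = n * n" "reg s0 3 = 1" "r \<notin> {0,3} \<Longrightarrow> reg s0 r = 0" for r
    using assms by (auto simp: s0_def init_config_def)
  have 4: "reg s1 4 = n"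
    unfolding s1_def by (subst sem_sqrt_com) (use i n in auto)
  have "reg s2 8 = n * ceil_log2 n"
    unfolding s2_def by (subst sem_log_com) (use i r1 4 n in auto)
  then have "reg s3 8 = 32 * (n * ceil_log2 n)"
    by (simp add: s3_def)
  then have 9: "reg s4 9 = threshold n"
    unfolding s4_def threshold_def by (subst sem_sqrt_com) (use i r1 r2 r3 in auto)
  have s4: "reg s4 0 = n * n" "reg s4 3 = 1" "reg s4 4 = n"
    using i 4 r1 r2 r3 r4 by auto
  define R where "R = similar n (threshold n) (mem s0)"
  have mem5: "mem s5 (n * n + x) = label R n x" for x
    using sem_label_com[of s4 x] s4 9 m unfolding R_def s5_def
    by (simp add: s0_def init_config_def assms)
  have mem6: "mem s6 x = label R n x" if "x < n" for x
    unfolding s6_def by (subst sem_copy_com) (use that s4 r5 n mem5 in auto)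
  \<comment> \<open>Memory holds 0 and 1 in place of the input bits, but similarity depends only on
    which entries are equal.\<close>
  have "similar n (threshold n) (\<lambda>x. x < n * n \<and> w ! x) = R"
  proof -
    have "(mem s0 x = mem s0 y) = ((x < n * n \<and> w ! x) = (y < n * n \<and> w ! y))" for x y
      using assms by (auto simp: s0_def init_config_def)
    then show ?thesis unfolding R_def similar_def by (intro ext) simp
  qed
  then show ?thesis
    using mem6 r6 r5 s4 unfolding run_def Let_def s0_def[symmetric] s6 by simp
qed

section \<open>Concentration of the agreements\<close>

definition signum :: "bool \<Rightarrow> real" where
  "signum b = (if b then 1 else - 1)"

text \<open>The coordinates \<open>u\<close> and \<open>v\<close> are left out: they involve the
  diagonal and share the edge between \<open>u\<close> and \<open>v\<close>. The others use pairwise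
  disjoint pairs of edges.\<close>

definition correlation :: "nat \<Rightarrow> (nat set \<Rightarrow> bool) \<Rightarrow> nat \<Rightarrow> nat \<Rightarrow> real" where
  "correlation n X u v = (\<Sum>w\<in>{..<n} - {u, v}. signum (X {u, w}) * signum (X {v, w}))"

lemma finite_vertex_pairs [simp]: "finite (vertex_pairs n)"
  unfolding vertex_pairs_def by simp

lemma doubleton_in_vertex_pairs_iff: "{u, v} \<in> vertex_pairs n \<longleftrightarrow> u < n \<and> v < n \<and> u \<noteq> v"
  by (auto simp: vertex_pairs_def card_2_iff doubleton_eq_iff)

text \<open>A sign with success probability \<open>p\<close> has mean \<open>2 p - 1\<close>, and
  independence of the two edges multiplies the means. Hoeffding's inequality applies to
  \<open>n - 2\<close> independent summands in \<open>[-1, 1]\<close>.\<close>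

lemma prob_correlation_deviation:
  fixes p :: "nat set \<Rightarrow> real"
  assumes "u < n" "v < n" "u \<noteq> v" "2 < n" "0 \<le> \<epsilon>" and p: "\<And>e. 0 \<le> p e \<and> p e \<le> 1"
  shows "measure_pmf.prob (Pi_pmf (vertex_pairs n) False (\<lambda>e. bernoulli_pmf (p e)))
      {X. \<epsilon> \<le> \<bar>correlation n X u v - (\<Sum>w\<in>{..<n} - {u, v}. (2 * p {u, w} - 1) * (2 * p {v, w} - 1))\<bar>}
    \<le> 2 * exp (- \<epsilon>\<^sup>2 / (2 * (real n - 2)))"
proof -
  let ?M = "Pi_pmf (vertex_pairs n) False (\<lambda>e. bernoulli_pmf (p e))"
  let ?I = "{..<n} - {u, v}"
  let ?Y = "\<lambda>w X. signum (X {u, w}) * signum (X {v, w})"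
  let ?K = "\<lambda>w. {{u, w}, {v, w}}"
  have mean: "measure_pmf.expectation ?M (?Y w) = (2 * p {u, w} - 1) * (2 * p {v, w} - 1)"
    if w: "w \<in> ?I" for w
  proof -
    have ne: "{u, w} \<noteq> {v, w}" using assms w by (auto simp: doubleton_eq_iff)
    have sub: "?K w \<subseteq> vertex_pairs n"
      using assms w by (auto simp: doubleton_in_vertex_pairs_iff)
    have "prob_space.indep_vars ?M (\<lambda>_. count_space UNIV) (\<lambda>e X. X e) (?K w)"
      using prob_space.indep_vars_subset[OF measure_pmf.prob_space_axioms indep_vars_Pi_pmf sub]
      by simp
    then have "prob_space.indep_vars ?M (\<lambda>_. borel) (\<lambda>e X. signum (X e)) (?K w)"
      by (rule prob_space.indep_vars_compose2[OF measure_pmf.prob_space_axioms]) simp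
    then have "measure_pmf.expectation ?M (\<lambda>X. \<Prod>e\<in>?K w. signum (X e)) =
        (\<Prod>e\<in>?K w. measure_pmf.expectation ?M (\<lambda>X. signum (X e)))"
      by (intro prob_space.indep_vars_lebesgue_integral[OF measure_pmf.prob_space_axioms])
        (auto intro!: measure_pmf.integrable_const_bound[where B = 1] simp: signum_def)
    moreover have "measure_pmf.expectation ?M (\<lambda>X. signum (X e)) = 2 * p e - 1"
      if "e \<in> vertex_pairs n" for e
    proof -
      have "measure_pmf.expectation ?M (\<lambda>X. signum (X e)) =
          measure_pmf.expectation (map_pmf (\<lambda>X. X e) ?M) signum" by simp
      also have "\<dots> = 2 * p e - 1"
        using p[of e] that
        by (simp only: Pi_pmf_component finite_vertex_pairs if_True)
           (simp add: signum_def integral_measure_pmf[of UNIV] UNIV_bool)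
      finally show ?thesis .
    qed
    ultimately show ?thesis using ne sub by simp
  qed
  have indep: "prob_space.indep_vars ?M (\<lambda>_. borel) ?Y ?I"
  proof -
    have *: "prob_space.indep_vars ?M (\<lambda>w. PiM (?K w) (\<lambda>_. count_space UNIV))
        (\<lambda>w X. restrict (\<lambda>e. X e) (?K w)) ?I"
    proof (rule prob_space.indep_vars_restrict[OF measure_pmf.prob_space_axioms indep_vars_Pi_pmf])
      \<comment> \<open>A common edge of the blocks of \<open>w\<close> and \<open>w'\<close> would
        force \<open>u = w'\<close> or \<open>v = w'\<close> when \<open>w\<close> and
        \<open>w'\<close> differ, and both are excluded.\<close>
      show "disjoint_family_on ?K ?I"
        using assms by (auto simp: disjoint_family_on_def doubleton_eq_iff)
    qed (use assms in \<open>auto simp: doubleton_in_vertex_pairs_iff\<close>)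
    have "prob_space.indep_vars ?M (\<lambda>_. borel)
        (\<lambda>w X. (\<lambda>g. signum (g {u, w}) * signum (g {v, w})) (restrict (\<lambda>e. X e) (?K w))) ?I"
    proof (rule prob_space.indep_vars_compose2[OF measure_pmf.prob_space_axioms *])
      fix w
      have [measurable]: "signum \<in> borel_measurable (count_space UNIV)" by simp
      show "(\<lambda>g. signum (g {u, w}) * signum (g {v, w})) \<in>
          borel_measurable (PiM (?K w) (\<lambda>_. count_space UNIV))"
        by measurable
    qed
    then show ?thesis by simp
  qed
  interpret Hoeffding_ineq "measure_pmf ?M" ?I ?Y "\<lambda>_. - 1" "\<lambda>_. 1"
    "\<Sum>w\<in>?I. measure_pmf.expectation ?M (?Y w)"
    by unfold_locales (use indep in \<open>auto simp: signum_def\<close>)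
  have "card ?I = n - 2" using assms by (simp add: card_Diff_subset)
  then have sq: "(\<Sum>w\<in>?I. (1 - (- 1 :: real))\<^sup>2) = 4 * (real n - 2)"
    using assms by (simp add: of_nat_diff)
  have "measure_pmf.prob ?M {X \<in> space ?M. \<epsilon> \<le> \<bar>(\<Sum>w\<in>?I. ?Y w X) - (\<Sum>w\<in>?I. measure_pmf.expectation ?M (?Y w))\<bar>}
      \<le> 2 * exp (- 2 * \<epsilon>\<^sup>2 / (\<Sum>w\<in>?I. (1 - (- 1 :: real))\<^sup>2))"
    by (rule Hoeffding_ineq_abs_ge) (use assms sq in auto)
  also have "- 2 * \<epsilon>\<^sup>2 / (\<Sum>w\<in>?I. (1 - (- 1 :: real))\<^sup>2) = - \<epsilon>\<^sup>2 / (2 * (real n - 2))"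
    unfolding sq using assms by (simp add: field_simps)
  finally show ?thesis
    using mean by (simp add: correlation_def)
qed

text \<open>The factor \<open>2 p - 1\<close> is 1 on planted edges and 0 elsewhere. If both edges
  at \<open>w\<close> are planted, their cliques meet in \<open>w\<close> and hence coincide, so the
  sum counts the clique vertices other than \<open>u\<close> and \<open>v\<close>.\<close>

lemma sum_planted_mean:
  fixes n k u v :: nat
  assumes "partition_on S P" "S \<subseteq> {..<n}" "\<And>C. C \<in> P \<Longrightarrow> card C = k" "u \<noteq> v"
  defines "p \<equiv> \<lambda>e. if \<exists>C\<in>P. e \<subseteq> C then 1 else 1 / 2 :: real"
  shows "(\<Sum>w\<in>{..<n} - {u, v}. (2 * p {u, w} - 1) * (2 * p {v, w} - 1)) =
     (if \<exists>C\<in>P. {u, v} \<subseteq> C then real k - 2 else 0)"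
proof -
  have disj: "C = D" if "C \<in> P" "D \<in> P" "x \<in> C" "x \<in> D" for C D x
    using assms(1) that by (auto simp: partition_on_def disjoint_def)
  have summand: "(2 * p {u, w} - 1) * (2 * p {v, w} - 1) = of_bool (\<exists>C\<in>P. {u, v, w} \<subseteq> C)" for w
    unfolding p_def using disj by (auto split: if_splits)
  have sum: "(\<Sum>w\<in>{..<n} - {u, v}. (2 * p {u, w} - 1) * (2 * p {v, w} - 1)) =
      card {w \<in> {..<n} - {u, v}. \<exists>C\<in>P. {u, v, w} \<subseteq> C}"
    unfolding summand by (subst sum_of_bool_eq) (auto intro!: arg_cong[where f = card])
  show ?thesis
  proof (cases "\<exists>C\<in>P. {u, v} \<subseteq> C")
    case True
    then obtain C where C: "C \<in> P" "u \<in> C" "v \<in> C" by auto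
    have "C \<subseteq> {..<n}" using C assms by (auto simp: partition_on_def)
    then have "finite C" by (rule finite_subset) simp
    have "{w \<in> {..<n} - {u, v}. \<exists>C\<in>P. {u, v, w} \<subseteq> C} = C - {u, v}"
      using C disj \<open>C \<subseteq> {..<n}\<close> by auto
    moreover have "card (C - {u, v}) = k - 2"
      using C assms \<open>finite C\<close> by (simp add: card_Diff_subset)
    moreover have "card {u, v} \<le> card C"
      by (rule card_mono) (use C \<open>finite C\<close> in auto)
    then have "2 \<le> k" using assms C by simp
    ultimately show ?thesis using sum True by (simp add: of_nat_diff)
  next
    case False
    then have "{w \<in> {..<n} - {u, v}. \<exists>C\<in>P. {u, v, w} \<subseteq> C} = {}" by auto
    then show ?thesis unfolding sum if_not_P[OF False] by simp
  qed
qed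

section \<open>Recovery\<close>

lemma label_eq_Suc:
  assumes "m < n" "marked R m m x" "\<And>u. \<lbrakk>m < u; u < n\<rbrakk> \<Longrightarrow> \<not> marked R u u x"
  shows "label R n x = Suc m"
  using assms
proof (induction n)
  case (Suc n)
  then show ?case by (cases "m = n") auto
qed simp

lemma label_eq_0: "(\<And>u. u < n \<Longrightarrow> \<not> marked R u u x) \<Longrightarrow> label R n x = 0"
  by (induction n) auto

text \<open>The largest vertex of a clique performs the last pass that marks any of its members. It
  marks itself only through a smaller similar vertex, which is where cliques of size at least 2 are
  used.\<close>

lemma exactly_recovers_label:
  assumes P: "partition_on S P" "S \<subseteq> {..<n}" and card: "\<And>C. C \<in> P \<Longrightarrow> 2 \<le> card C"
    and R: "\<And>u v. \<lbrakk>v < u; u < n\<rbrakk> \<Longrightarrow> R u v \<longleftrightarrow> (\<exists>C\<in>P. {u, v} \<subseteq> C)"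
  shows "exactly_recovers n (map (label R n) [0..<n]) P"
proof -
  have disj: "C = D" if "C \<in> P" "D \<in> P" "x \<in> C" "x \<in> D" for C D x
    using P(1) that by (auto simp: partition_on_def disjoint_def)
  have sub: "C \<subseteq> {..<n}" if "C \<in> P" for C
    using P that by (auto simp: partition_on_def)
  have fin: "finite C" "Max C \<in> C" if "C \<in> P" for C
  proof -
    show "finite C" using sub[OF that] finite_subset by blast
    then show "Max C \<in> C" using card[OF that] by (intro Max_in) auto
  qed
  have clique: "label R n x = Suc (Max C)" if C: "C \<in> P" "x \<in> C" for x C
  proof (rule label_eq_Suc)
    show "Max C < n" using fin sub C by blast
    have le: "y \<le> Max C" if "y \<in> C" for y
      using fin C that by simp
    show "marked R (Max C) (Max C) x"
    proof (cases "x = Max C")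
      case False
      then have "x < Max C" using le C by fastforce
      then show ?thesis using R[of x "Max C"] \<open>Max C < n\<close> C fin by (auto simp: marked_def)
    next
      case True
      have "\<not> C \<subseteq> {x}" using card[OF C(1)] card_mono[of "{x}" C] by auto
      then obtain y where "y \<in> C" "y \<noteq> x" by auto
      then have "y < Max C" using le True by fastforce
      moreover have "R (Max C) y" using R[of y "Max C"] \<open>Max C < n\<close> C fin \<open>y \<in> C\<close> calculation by auto
      ultimately show ?thesis using True by (auto simp: marked_def)
    qed
    \<comment> \<open>A later pass marking \<open>x\<close> would make \<open>u\<close> similar to
      \<open>x\<close>, placing \<open>u\<close> in the clique of \<open>x\<close> above its
      maximum.\<close>
    fix u assume u: "Max C < u" "u < n"
    then have "u \<notin> C" "x < u" using le C by fastforce+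
    then show "\<not> marked R u u x"
      using R[of x u] u C disj by (auto simp: marked_def)
  qed
  have non_clique: "label R n x = 0" if "x \<notin> \<Union>P" for x
    using that R by (intro label_eq_0) (auto simp: marked_def)
  have pos: "label R n x > 0 \<longleftrightarrow> x \<in> \<Union>P" for x
    using clique non_clique by (metis Union_iff less_numeral_extra(3) zero_less_Suc)
  \<comment> \<open>Distinct cliques have distinct maxima because they are disjoint, so different
    cliques never share a label.\<close>
  have block: "{v. v < n \<and> label R n v = Suc (Max C)} = C" if C: "C \<in> P" for C
  proof (intro set_eqI iffI; clarsimp)
    fix v assume "label R n v = Suc (Max C)"
    then obtain D where "D \<in> P" "v \<in> D" using pos[of v] by auto
    moreover then have "Max D = Max C"
      using clique[of D v] \<open>label R n v = Suc (Max C)\<close> by simp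
    ultimately show "v \<in> C"
      using disj[of C D "Max C"] fin C by metis
  next
    fix v assume "v \<in> C" then show "v < n \<and> label R n v = Suc (Max C)"
      using clique C sub by auto
  qed
  let ?xs = "map (label R n) [0..<n]"
  have "clique_partition ?xs = (\<lambda>c. {v. v < n \<and> label R n v = c}) ` {c \<in> label R n ` {..<n}. 0 < c}"
    unfolding clique_partition_def by (intro image_cong) (auto simp: atLeast0LessThan)
  also have "{c \<in> label R n ` {..<n}. 0 < c} = (\<lambda>C. Suc (Max C)) ` P"
  proof safe
    fix x assume "x < n" "0 < label R n x"
    then obtain C where "C \<in> P" "x \<in> C" using pos by auto
    then show "label R n x \<in> (\<lambda>C. Suc (Max C)) ` P" using clique by auto
  next
    fix C assume "C \<in> P"
    then show "Suc (Max C) \<in> label R n ` {..<n}"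
      using clique[of C "Max C"] fin sub by (metis image_eqI subsetD)
  qed
  also have "(\<lambda>c. {v. v < n \<and> label R n v = c}) ` (\<lambda>C. Suc (Max C)) ` P = P"
    using block by (simp add: image_image)
  finally have "clique_partition ?xs = P" .
  moreover have "non_clique_vertices ?xs = {..<n} - \<Union>P"
    using pos by (auto simp: non_clique_vertices_def) (metis Union_iff neq0_conv)+
  ultimately show ?thesis by (simp add: exactly_recovers_def)
qed

text \<open>A product of two signs is 1 for an agreement and -1 for a disagreement. The two
  coordinates missing from \<open>correlation\<close> contribute at most 1 each in absolute
  value.\<close>

lemma agreements_correlation:
  assumes "u < n" "v < n" "u \<noteq> v" and m: "\<And>x w. \<lbrakk>x < n; w < n\<rbrakk> \<Longrightarrow> m (x * n + w) = (x \<noteq> w \<and> X {x, w})"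
  shows "\<bar>2 * real (card {w. w < n \<and> m (u * n + w) = m (v * n + w)}) - real n - correlation n X u v\<bar> \<le> 2"
proof -
  let ?f = "\<lambda>w. signum (m (u * n + w)) * signum (m (v * n + w))"
  have "real (card {w. w < n \<and> m (u * n + w) = m (v * n + w)}) =
      (\<Sum>w<n. of_bool (m (u * n + w) = m (v * n + w)))"
    by (subst sum_of_bool_eq) (auto intro!: arg_cong[where f = card])
  also have "\<dots> = (\<Sum>w<n. (1 + ?f w) / 2)"
    by (rule sum.cong) (auto simp: signum_def)
  also have "\<dots> = (real n + (\<Sum>w<n. ?f w)) / 2"
    by (simp add: sum.distrib flip: sum_divide_distrib)
  finally have "2 * real (card {w. w < n \<and> m (u * n + w) = m (v * n + w)}) - real n = (\<Sum>w<n. ?f w)"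
    by simp
  also have "\<dots> = (\<Sum>w\<in>{..<n} - {u, v}. ?f w) + (\<Sum>w\<in>{u, v}. ?f w)"
    by (rule sum.subset_diff) (use assms in auto)
  also have "(\<Sum>w\<in>{..<n} - {u, v}. ?f w) = correlation n X u v"
    unfolding correlation_def by (rule sum.cong) (use assms in auto)
  finally show ?thesis
    using assms(3) by (auto simp: signum_def)
qed

text \<open>Write \<open>t\<close> for the threshold. The score differs from its mean by less than
  \<open>t/2 + 2\<close>. Within a clique it exceeds \<open>k - 4 - t/2\<close>, which is at least
  \<open>t\<close>; otherwise it is below \<open>t/2 + 2\<close>, which is at most \<open>t\<close>
  as \<open>t \<ge> 4\<close>.\<close>

lemma exactly_recovers_run:
  assumes P: "partition_on S P" "S \<subseteq> {..<n}" and card: "\<And>C. C \<in> P \<Longrightarrow> card C = k"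
    and t: "4 \<le> threshold n" "4 + 3 * real (threshold n) / 2 \<le> real k"
    and dev: "\<And>u v. \<lbrakk>u < n; v < n; u \<noteq> v\<rbrakk> \<Longrightarrow>
      \<bar>correlation n X u v - (if \<exists>C\<in>P. {u, v} \<subseteq> C then real k - 2 else 0)\<bar> < real (threshold n) / 2"
  shows "exactly_recovers n (run recovery_com 4 (encode_graph n {e \<in> vertex_pairs n. X e})) P"
proof -
  let ?w = "encode_graph n {e \<in> vertex_pairs n. X e}"
  let ?m = "\<lambda>x. x < n * n \<and> ?w ! x"
  have len: "length ?w = n * n" by (simp add: encode_graph_def)
  have m: "?m (x * n + w) = (x \<noteq> w \<and> X {x, w})" if "x < n" "w < n" for x w
    using that row_address[of x n w] by (auto simp: encode_graph_def doubleton_in_vertex_pairs_iff)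
  have "similar n (threshold n) ?m u v \<longleftrightarrow> (\<exists>C\<in>P. {u, v} \<subseteq> C)" if uv: "v < u" "u < n" for u v
  proof -
    let ?d = "card {w. w < n \<and> ?m (u * n + w) = ?m (v * n + w)}"
    have close: "\<bar>2 * real ?d - real n - correlation n X u v\<bar> \<le> 2"
      by (rule agreements_correlation) (use uv m in auto)
    have sim: "similar n (threshold n) ?m u v \<longleftrightarrow> real (threshold n) \<le> 2 * real ?d - real n"
      unfolding similar_def using t(1) by linarith
    have t4: "4 \<le> real (threshold n)" using t(1) by simp
    have dv: "\<bar>correlation n X u v - (if \<exists>C\<in>P. {u, v} \<subseteq> C then real k - 2 else 0)\<bar>
        < real (threshold n) / 2"
      by (rule dev) (use uv in auto)
    show ?thesis
    proof (cases "\<exists>C\<in>P. {u, v} \<subseteq> C")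
      case True
      have "real (threshold n) \<le> 2 * real ?d - real n"
        using close t(2) t4 dv unfolding if_P[OF True] by linarith
      with sim True show ?thesis by blast
    next
      case False
      have "\<not> real (threshold n) \<le> 2 * real ?d - real n"
        using close t4 dv unfolding if_not_P[OF False] by linarith
      with sim False show ?thesis by blast
    qed
  qed
  moreover have "2 \<le> k" using t by linarith
  ultimately show ?thesis
    unfolding run_recovery_com[OF len] by (intro exactly_recovers_label[OF P]) (use card in auto)
qed

lemma prob_not_recovered:
  assumes P: "partition_on S P" "S \<subseteq> {..<n}" and card: "\<And>C. C \<in> P \<Longrightarrow> card C = k"
    and t: "4 \<le> threshold n" "4 + 3 * real (threshold n) / 2 \<le> real k" and n: "2 < n"
  shows "measure_pmf.prob (planted_graph n P)
      {G. \<not> exactly_recovers n (run recovery_com 4 (encode_graph n G)) P}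
    \<le> real n ^ 2 * (2 * exp (- (real (threshold n) / 2)\<^sup>2 / (2 * (real n - 2))))"
proof -
  define p where "p = (\<lambda>e. if \<exists>C\<in>P. e \<subseteq> C then 1 else 1 / 2 :: real)"
  let ?M = "Pi_pmf (vertex_pairs n) False (\<lambda>e. bernoulli_pmf (p e))"
  let ?\<mu> = "\<lambda>u v. if \<exists>C\<in>P. {u, v} \<subseteq> C then real k - 2 else 0"
  let ?B = "\<lambda>(u, v). {X. real (threshold n) / 2 \<le> \<bar>correlation n X u v - ?\<mu> u v\<bar>}"
  let ?I = "{(u, v). u < n \<and> v < n \<and> u \<noteq> v}"
  let ?b = "2 * exp (- (real (threshold n) / 2)\<^sup>2 / (2 * (real n - 2)))"
  have I: "?I \<subseteq> {..<n} \<times> {..<n}" by auto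
  then have fin: "finite ?I" by (rule finite_subset) simp
  have B: "measure_pmf.prob ?M (?B uv) \<le> ?b" if I: "uv \<in> ?I" for uv
  proof -
    obtain u v where uv: "uv = (u, v)" "u < n" "v < n" "u \<noteq> v"
      using I by (cases uv) auto
    have "(\<Sum>w\<in>{..<n} - {u, v}. (2 * p {u, w} - 1) * (2 * p {v, w} - 1)) = ?\<mu> u v"
      unfolding p_def by (rule sum_planted_mean[OF P card \<open>u \<noteq> v\<close>])
    then show ?thesis
      using prob_correlation_deviation[of u n v "real (threshold n) / 2" p] uv n
      by (simp add: p_def)
  qed
  have "measure_pmf.prob (planted_graph n P)
      {G. \<not> exactly_recovers n (run recovery_com 4 (encode_graph n G)) P} =
    measure_pmf.prob ?M
      {X. \<not> exactly_recovers n (run recovery_com 4 (encode_graph n {e \<in> vertex_pairs n. X e})) P}"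
    by (simp add: planted_graph_def p_def vimage_def)
  also have "\<dots> \<le> measure_pmf.prob ?M (\<Union>uv\<in>?I. ?B uv)"
  proof (rule measure_pmf.finite_measure_mono)
    show "{X. \<not> exactly_recovers n (run recovery_com 4 (encode_graph n {e \<in> vertex_pairs n. X e})) P}
      \<subseteq> (\<Union>uv\<in>?I. ?B uv)"
    proof (rule subsetI, rule ccontr)
      fix X assume X: "X \<in> {X. \<not> exactly_recovers n (run recovery_com 4 (encode_graph n {e \<in> vertex_pairs n. X e})) P}"
        and notin: "X \<notin> (\<Union>uv\<in>?I. ?B uv)"
      have "\<bar>correlation n X u v - ?\<mu> u v\<bar> < real (threshold n) / 2" if "u < n" "v < n" "u \<noteq> v" for u v
      proof -
        have "(u, v) \<in> ?I" using that by simp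
        with notin have "X \<notin> ?B (u, v)" by blast
        then show ?thesis by (simp only: case_prod_conv mem_Collect_eq not_le)
      qed
      from exactly_recovers_run[OF P card t this] X show False by simp
    qed
  qed simp
  also have "\<dots> \<le> (\<Sum>uv\<in>?I. measure_pmf.prob ?M (?B uv))"
    by (rule measure_pmf.finite_measure_subadditive_finite) (use fin in auto)
  also have "\<dots> \<le> real (card ?I) * ?b"
    by (rule sum_bounded_above) (rule B)
  also have "\<dots> \<le> real n ^ 2 * ?b"
    using card_mono[OF _ I] by (intro mult_right_mono) (auto simp: power2_eq_square simp flip: of_nat_mult)
  finally show ?thesis .
qed

section \<open>Size of the threshold and failure probability\<close>

lemma ln_le_ceil_log2: "ln (real n) \<le> real (ceil_log2 n)"
proof (cases "n = 0")
  case False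
  have "n \<le> 2 ^ ceil_log2 n" using less_ceil_log2_iff[of "ceil_log2 n" n] by simp
  then have "ln (real n) \<le> ln (2 ^ ceil_log2 n)"
    using False by (subst ln_le_cancel_iff) (simp_all flip: of_nat_le_iff)
  also have "\<dots> \<le> real (ceil_log2 n) * 1"
    unfolding ln_realpow by (intro mult_left_mono) (use ln_2_less_1 in auto)
  finally show ?thesis by simp
qed simp

lemma ln_ge_1: "3 \<le> n \<Longrightarrow> 1 \<le> ln (real n)"
  using exp_le by (subst ln_ge_iff) auto

lemma ceil_log2_le_ln:
  assumes "3 \<le> n"
  shows "real (ceil_log2 n) \<le> 3 * ln (real n)"
proof -
  have "0 < ceil_log2 n" using less_ceil_log2_iff[of 0 n] assms by simp
  then obtain l where l: "ceil_log2 n = Suc l" by (metis Suc_pred)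
  then have "2 ^ l < n" using less_ceil_log2_iff[of l n] by simp
  then have "(2::real) ^ l \<le> real n" by (metis less_imp_le of_nat_le_iff of_nat_numeral of_nat_power)
  then have "ln (2 ^ l) \<le> ln (real n)" using assms by (subst ln_le_cancel_iff) auto
  then have "real l * ln 2 \<le> ln (real n)" by (simp add: ln_realpow)
  moreover have "1 / 2 \<le> ln (2::real)" using ln2_ge_two_thirds by linarith
  then have "real l * (1 / 2) \<le> real l * ln 2" by (intro mult_left_mono) auto
  \<comment> \<open>Since \<open>l \<le> 2 ln n\<close>, rounding up costs one more
    \<open>ln n\<close>, which is at least 1.\<close>
  ultimately show ?thesis using l ln_ge_1[OF assms] by simp
qed

lemma threshold_lower:
  assumes "6 \<le> n"
  shows "32 * (real n * ln (real n)) \<le> (real (threshold n))\<^sup>2"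
proof (cases "n * n \<le> ceil_sqrt (32 * (n * ceil_log2 n))")
  case True
  have "36 \<le> real n * real n" using mult_mono[of 6 "real n" 6 "real n"] assms by simp
  have "32 * (real n * ln (real n)) \<le> real n * real n * (real n * real n)"
    using \<open>36 \<le> real n * real n\<close> ln_le_minus_one[of "real n"] assms
    by (intro mult_mono) auto
  with True show ?thesis by (simp add: threshold_def power2_eq_square)
next
  case False
  let ?m = "32 * (n * ceil_log2 n)"
  have "?m \<le> ceil_sqrt ?m * ceil_sqrt ?m" using less_ceil_sqrt_iff[of "ceil_sqrt ?m" ?m] by simp
  then have "real ?m \<le> (real (threshold n))\<^sup>2"
    using False unfolding threshold_def power2_eq_square of_nat_mult[symmetric] of_nat_le_iff
    by simp
  moreover have "32 * (real n * ln (real n)) \<le> real ?m"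
    using ln_le_ceil_log2[of n] by (simp add: mult_left_mono)
  ultimately show ?thesis by linarith
qed

text \<open>The summand 1 pays for rounding the square root up. The factor 10 comes from
  \<open>32 * 3 = 96 \<le> 100\<close>, where 3 compares \<open>ceil_log2\<close> with
  \<open>ln\<close>.\<close>

lemma threshold_upper:
  assumes "6 \<le> n"
  shows "real (threshold n) \<le> 10 * sqrt (real n * ln (real n)) + 1"
proof -
  let ?m = "32 * (n * ceil_log2 n)"
  have "(real (threshold n) - 1)\<^sup>2 \<le> real ?m"
  proof (cases "ceil_sqrt ?m")
    case 0
    then show ?thesis using assms less_ceil_sqrt_iff[of 0 ?m] less_ceil_log2_iff[of 0 n] by simp
  next
    case (Suc j)
    then have "j * j < ?m" using less_ceil_sqrt_iff[of j ?m] by simp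
    moreover have "1 \<le> n * n" using assms by simp
    then have "1 \<le> threshold n" "threshold n \<le> Suc j"
      using Suc unfolding threshold_def by linarith+
    then have "(real (threshold n) - 1)\<^sup>2 \<le> (real j)\<^sup>2"
      by (intro power_mono) auto
    ultimately show ?thesis
      by (smt (verit) of_nat_less_iff of_nat_mult power2_eq_square)
  qed
  also have "\<dots> \<le> 100 * (real n * ln (real n))"
  proof -
    have "real n * real (ceil_log2 n) \<le> real n * (3 * ln (real n))"
      by (intro mult_left_mono ceil_log2_le_ln) (use assms in auto)
    moreover have "0 \<le> real n * ln (real n)" using assms ln_ge_1[of n] by simp
    ultimately show ?thesis by simp
  qed
  finally have "real (threshold n) - 1 \<le> sqrt (100 * (real n * ln (real n)))"
    by (rule real_le_rsqrt)
  also have "\<dots> = 10 * sqrt (real n * ln (real n))"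
    by (subst real_sqrt_mult) simp
  finally show ?thesis by simp
qed

text \<open>With \<open>r = sqrt (n ln n) \<ge> 2\<close>, the separation condition asks for
  \<open>k\<close> at least \<open>4 + 3 (10 r + 1) / 2 = 15 r + 5.5\<close>, which is below
  \<open>20 r\<close>.\<close>

lemma prob_MC_recovered:
  assumes law: "set_pmf law \<subseteq> planted_partitions n q \<delta>"
    and k: "real k = (1 - \<delta>) * real n / real q" "20 * sqrt (real n * ln (real n)) \<le> real k"
    and n: "6 \<le> n"
  shows "1 - 2 / real n ^ 2 \<le> measure_pmf.prob (MC n law)
     {(P, G). exactly_recovers n (run recovery_com 4 (encode_graph n G)) P}"
proof -
  let ?A = "{(P, G). exactly_recovers n (run recovery_com 4 (encode_graph n G)) P}"
  have ln: "1 \<le> ln (real n)" using ln_ge_1[of n] n by simp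
  have nln: "6 \<le> real n * ln (real n)" using mult_mono[of 6 "real n" 1 "ln (real n)"] ln n by simp
  have "2 \<le> sqrt (real n * ln (real n))"
    by (rule real_le_rsqrt) (use nln in simp)
  then have t2: "4 + 3 * real (threshold n) / 2 \<le> real k"
    using threshold_upper[OF n] k(2) by linarith
  have lower: "32 * (real n * ln (real n)) \<le> (real (threshold n))\<^sup>2"
    by (rule threshold_lower[OF n])
  have t1: "4 \<le> threshold n"
  proof (rule ccontr)
    assume "\<not> 4 \<le> threshold n"
    then have "(real (threshold n))\<^sup>2 \<le> 4\<^sup>2" by (intro power_mono) auto
    then show False using lower nln by simp
  qed
  have bound: "measure_pmf.prob (planted_graph n P)
      {G. \<not> exactly_recovers n (run recovery_com 4 (encode_graph n G)) P} \<le> 2 / real n ^ 2"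
    if P: "P \<in> set_pmf law" for P
  proof -
    obtain S where S: "partition_on S P" "S \<subseteq> {..<n}" "\<And>C. C \<in> P \<Longrightarrow> real (card C) = real k"
      using law P k(1) unfolding planted_partitions_def by auto
    have "measure_pmf.prob (planted_graph n P)
        {G. \<not> exactly_recovers n (run recovery_com 4 (encode_graph n G)) P}
      \<le> real n ^ 2 * (2 * exp (- (real (threshold n) / 2)\<^sup>2 / (2 * (real n - 2))))"
      by (rule prob_not_recovered[OF S(1,2) _ t1 t2]) (use S n in auto)
    also have "\<dots> \<le> real n ^ 2 * (2 * exp (- 4 * ln (real n)))"
    proof -
      \<comment> \<open>The right side is at least \<open>8 n ln n\<close>. The resulting exponent
        -4 leaves \<open>2 / n^2\<close> after the factor \<open>n^2\<close> of the union
        bound.\<close>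
      have "4 * ln (real n) * (2 * (real n - 2)) \<le> (real (threshold n) / 2)\<^sup>2"
        using lower ln by (simp add: power_divide algebra_simps)
      then have "4 * ln (real n) \<le> (real (threshold n) / 2)\<^sup>2 / (2 * (real n - 2))"
        using n by (subst pos_le_divide_eq) auto
      then show ?thesis by (intro mult_left_mono) auto
    qed
    also have "exp (- 4 * ln (real n)) = 1 / real n ^ 4"
      using n by (simp add: exp_minus exp_of_nat_mult[of 4, simplified] inverse_eq_divide)
    finally show ?thesis using n by (simp add: power2_eq_square power4_eq_xxxx divide_simps)
  qed
  \<comment> \<open>Conditioning on the planted partition: the failure bound holds for every
    partition in the support, hence also on average.\<close>
  have "emeasure (MC n law) (- ?A) = (\<integral>\<^sup>+P. emeasure (planted_graph n P)
      {G. \<not> exactly_recovers n (run recovery_com 4 (encode_graph n G)) P} \<partial>measure_pmf law)"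
    unfolding MC_def by (simp add: vimage_def)
  also have "\<dots> \<le> (\<integral>\<^sup>+P. ennreal (2 / real n ^ 2) \<partial>measure_pmf law)"
    by (intro nn_integral_mono_AE)
      (use bound in \<open>auto simp: AE_measure_pmf_iff measure_pmf.emeasure_eq_measure intro!: ennreal_leI\<close>)
  also have "\<dots> = ennreal (2 / real n ^ 2)" by simp
  finally have "measure_pmf.prob (MC n law) (- ?A) \<le> 2 / real n ^ 2"
    by (simp add: measure_pmf.emeasure_eq_measure)
  then show ?thesis
    using measure_pmf.prob_compl[of ?A "MC n law"] by (simp add: Compl_eq_Diff_UNIV)
qed

theorem theorem2p5:
  fixes q :: "nat \<Rightarrow> nat" and \<delta> :: "nat \<Rightarrow> real" and k :: "nat \<Rightarrow> nat"
  assumes "\<And>n. n > 0 \<Longrightarrow> q n > 0"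
    and "\<And>n. n > 0 \<Longrightarrow> 0 \<le> \<delta> n \<and> \<delta> n \<le> 1"
    and "\<And>n. n > 0 \<Longrightarrow> real (k n) = (1 - \<delta> n) * real n / real (q n)"
    and "\<And>n. n > 0 \<Longrightarrow> k n > 0"
    and "(\<lambda>n. real (k n)) \<in> \<omega>(\<lambda>n. sqrt (real n * ln (real n)))"
  shows "\<exists>A :: bool list \<Rightarrow> nat list. polynomial_time A \<and>
    (\<forall>law :: nat \<Rightarrow> nat set set pmf.
       (\<forall>n>0. set_pmf (law n) \<subseteq> planted_partitions n (q n) (\<delta> n)) \<longrightarrow>
       (\<lambda>n. measure_pmf.prob (MC n (law n))
              {(P, G). exactly_recovers n (A (encode_graph n G)) P}) \<longlonglongrightarrow> 1)"
proof (intro exI conjI allI impI)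
  show "polynomial_time (run recovery_com 4)"
    by (rule polynomial_time_run[OF wf_recovery_com])
  fix law :: "nat \<Rightarrow> nat set set pmf"
  assume law: "\<forall>n>0. set_pmf (law n) \<subseteq> planted_partitions n (q n) (\<delta> n)"
  \<comment> \<open>The growth of \<open>k\<close> enters only here, with the constant 20.\<close>
  have "\<forall>\<^sub>F n in sequentially. 20 * norm (sqrt (real n * ln (real n))) \<le> norm (real (k n))"
    by (rule landau_omega.smallD[OF assms(5)]) simp
  then have "\<forall>\<^sub>F n in sequentially. 1 - 2 / real n ^ 2 \<le> measure_pmf.prob (MC n (law n))
      {(P, G). exactly_recovers n (run recovery_com 4 (encode_graph n G)) P}"
    using eventually_ge_at_top[of 6]
  proof eventually_elim
    case (elim n)
    have "20 * sqrt (real n * ln (real n)) \<le> real (k n)" using elim(1) by simp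
    then show ?case
      using law elim(2) by (intro prob_MC_recovered[OF _ assms(3)]) auto
  qed
  then show "(\<lambda>n. measure_pmf.prob (MC n (law n))
      {(P, G). exactly_recovers n (run recovery_com 4 (encode_graph n G)) P}) \<longlonglongrightarrow> 1"
  proof (rule tendsto_sandwich[where h = "\<lambda>_. 1"])
    show "(\<lambda>n. 1 - 2 / real n ^ 2) \<longlonglongrightarrow> 1" by real_asymp
  qed (auto intro!: always_eventually)
qed

end
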